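(* Let $G$ be an infinite complete graph whose edges are colored arbitrarily, and let $n\in\mathrm{spec}(G)$. \begin{enumerate} \item[(i)] If $n\ge 3$ is odd, there is an integer $N\le 2n^2-13n+23$ such that $\{N+j\;|\;j\ge 0\}\subseteq \mathrm{spec}(G)$. \item[(ii)] If $n\equiv 2 \pmod 4$ and $n\ge 6$, there is an integer $N\le \tfrac94 n^2-18n+37$ such that $\{N+4j\;|\;j\ge 0\}\subseteq \mathrm{spec}(G)$. \item[(iii)] If $n$ is a positive multiple of $4$, there is an integer $N\le \tfrac92 n^2-39n+86$ such that $\{N+2j\;|\;j\ge 0\}\subseteq \mathrm{spec}(G)$. \end{enumerate}
   Context: An edge-colored graph is a graph together with an arbitrary assignment of a color $\gamma(u,v)$ to each edge $(u,v)$. For $m\ge 3$, an $m$-cycle is a closed walk $v_0\to v_1\to\cdots\to v_{m-1}\to v_0$ through $m$ pairwise distinct vertices; it is rainbow if its $m$ edges have pairwise distinct colors. For a complete, infinite, edge-colored graph $G$, $\mathrm{spec}(G)=\{m\ge 2\;|\;\text{no $m$-cycle of $G$ is rainbow}\}$; by convention $2\in\mathrm{spec}(G)$ always (a $2$-cycle traverses a single edge twice and is never rainbow). *)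

theory Defs
  imports Complex_Main "HOL-Library.Ramsey"
begin

text \<open>
  A simple graph is given by a vertex set \<open>V\<close> and a set \<open>E\<close> of two-element vertex sets.
  An edge coloring is a function on sets of vertices of which only the values on \<open>E\<close> matter, so
  the color of the edge joining \<open>u\<close> and \<open>v\<close> is \<open>\<gamma> {u, v}\<close>; neither finiteness nor
  properness is required.
\<close>

definition complete_graph :: "'a set \<Rightarrow> 'a set set \<Rightarrow> bool" where
  "complete_graph V E \<longleftrightarrow> E = nsets V 2"

text \<open>
  The list \<open>[v\<^sub>0, \<dots>, v\<^sub>m\<^sub>-\<^sub>1]\<close> encodes the closed walk
  \<open>v\<^sub>0 \<rightarrow> v\<^sub>1 \<rightarrow> \<dots> \<rightarrow> v\<^sub>m\<^sub>-\<^sub>1 \<rightarrow> v\<^sub>0\<close>; its step number \<open>i\<close> traverses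
  \<open>cycle_edge vs i\<close>.
\<close>

definition cycle_edge :: "'a list \<Rightarrow> nat \<Rightarrow> 'a set" where
  "cycle_edge vs i = {vs ! i, vs ! (Suc i mod length vs)}"

text \<open>The case \<open>m = 2\<close> is allowed: such a cycle traverses a single edge twice.\<close>

definition is_cycle :: "'a set \<Rightarrow> 'a set set \<Rightarrow> nat \<Rightarrow> 'a list \<Rightarrow> bool" where
  "is_cycle V E m vs \<longleftrightarrow>
     m \<ge> 2 \<and> length vs = m \<and> distinct vs \<and> set vs \<subseteq> V \<and> (\<forall>i<m. cycle_edge vs i \<in> E)"

definition rainbow :: "('a set \<Rightarrow> 'c) \<Rightarrow> 'a list \<Rightarrow> bool" where
  "rainbow \<gamma> vs \<longleftrightarrow> inj_on (\<lambda>i. \<gamma> (cycle_edge vs i)) {..<length vs}"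

definition spec :: "'a set \<Rightarrow> 'a set set \<Rightarrow> ('a set \<Rightarrow> 'c) \<Rightarrow> nat set" where
  "spec V E \<gamma> = {m. m \<ge> 2 \<and> \<not> (\<exists>vs. is_cycle V E m vs \<and> rainbow \<gamma> vs)}"

lemma two_in_spec: "2 \<in> spec V E \<gamma>"
proof -
  have "\<not> rainbow \<gamma> vs" if "is_cycle V E 2 vs" for vs
  proof -
    have l: "length vs = 2" using that by (simp add: is_cycle_def)
    have "cycle_edge vs 0 = cycle_edge vs 1"
      by (simp add: cycle_edge_def l insert_commute)
    then show ?thesis
      using l inj_onD[of "\<lambda>i. \<gamma> (cycle_edge vs i)" "{..<2}" 0 1] by (auto simp: rainbow_def)
  qed
  then show ?thesis by (auto simp: spec_def)
qed

end

theory Submission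
  imports Defs "HOL-Number_Theory.Cong"
begin

text \<open>
  Write \<open>t = n - 2\<close>. Cutting a cycle along a chord shows that the lengths \<open>m\<close>, shifted to \<open>m - 2\<close>, for which
  there is no rainbow \<open>m\<close>-cycle form an additive monoid \<open>T\<close> containing \<open>t\<close>; so on a longer rainbow cycle a
  chord cutting off \<open>jt + 1\<close> edges has the color of one of these edges. Comparing such chords, with
  \<open>j = 1, 2\<close>, along \<open>n\<close>-cycles that use few chords locates these colors precisely. If \<open>t\<close> divides
  the length, then, depending only on its starting point modulo \<open>t\<close>, each of these chords has the color of
  the first or of the last edge that it cuts off, which in turn pins down the colors of the chords of span 3.
  For odd \<open>t\<close> this excludes rainbow cycles of length \<open>3t\<close>, and a similar analysis excludes \<open>3t + 1\<close>.
  For even \<open>t\<close> a rainbow cycle of length \<open>2bt - 2\<close> is cut by a diameter into two closed walks of length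
  \<open>bt\<close>, one of which is rainbow; there every chord of span 3 has a color that it cuts off, and shortening
  the long cycle along \<open>t/2 - 2\<close> of them gives a length known to be excluded. Hence \<open>T\<close> contains
  \<open>t\<close>, \<open>3t - 2\<close>, \<open>3t - 1\<close> for odd \<open>t\<close>, and \<open>t\<close> and \<open>8t - 4\<close> (or \<open>6t - 4\<close> if \<open>t \<le> 18\<close>) for even \<open>t \<ge> 4\<close>;
  counting which numbers these generate gives the bounds.
\<close>

section \<open>Rainbow cycles as periodic sequences\<close>

text \<open>Carrying the vertex set and the color set as arguments turns the rainbow condition into
  disjointness of sets when paths are joined.\<close>

inductive rpath :: "('a set \<Rightarrow> 'c) \<Rightarrow> 'a \<Rightarrow> 'a \<Rightarrow> nat \<Rightarrow> 'a set \<Rightarrow> 'c set \<Rightarrow> bool" for \<gamma> where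
  single: "rpath \<gamma> x x 0 {x} {}"
| step: "\<lbrakk>rpath \<gamma> y z m A C; x \<notin> A; \<gamma> {x, y} \<notin> C\<rbrakk>
    \<Longrightarrow> rpath \<gamma> x z (Suc m) (insert x A) (insert (\<gamma> {x, y}) C)"

lemma rpath_link:
  assumes "rpath \<gamma> x y m A C" "rpath \<gamma> y' z k B D"
    and "A \<inter> B = {}" "C \<inter> D = {}" "\<gamma> {y, y'} \<notin> C \<union> D"
  shows "rpath \<gamma> x z (m + k + 1) (A \<union> B) (insert (\<gamma> {y, y'}) (C \<union> D))"
  using assms
proof (induction rule: rpath.induct)
  case (single x)
  then show ?case using rpath.step[of \<gamma> y' z k B D x] by simp
next
  case (step w y m A C x)
  have "rpath \<gamma> w z (m + k + 1) (A \<union> B) (insert (\<gamma> {y, y'}) (C \<union> D))"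
    using step by auto
  moreover have "x \<notin> A \<union> B" "\<gamma> {x, w} \<notin> insert (\<gamma> {y, y'}) (C \<union> D)"
    using step by auto
  ultimately have "rpath \<gamma> x z (Suc (m + k + 1)) (insert x (A \<union> B))
      (insert (\<gamma> {x, w}) (insert (\<gamma> {y, y'}) (C \<union> D)))"
    by (rule rpath.step)
  then show ?case by (simp add: insert_commute)
qed

lemma rpath_rev: "rpath \<gamma> x y m A C \<Longrightarrow> rpath \<gamma> y x m A C"
proof (induction rule: rpath.induct)
  case (single x)
  then show ?case by (rule rpath.single)
next
  case (step y z m A C x)
  have "rpath \<gamma> z x (m + 0 + 1) (A \<union> {x}) (insert (\<gamma> {y, x}) (C \<union> {}))"
    using step by (intro rpath_link rpath.single) (auto simp: insert_commute)
  then show ?case by (simp add: insert_commute)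
qed

lemma rpath_list:
  "rpath \<gamma> x z m A C \<Longrightarrow> \<exists>xs. length xs = Suc m \<and> xs ! 0 = x \<and> xs ! m = z \<and> distinct xs \<and> set xs = A
     \<and> inj_on (\<lambda>i. \<gamma> {xs ! i, xs ! Suc i}) {..<m} \<and> (\<lambda>i. \<gamma> {xs ! i, xs ! Suc i}) ` {..<m} = C"
proof (induction rule: rpath.induct)
  case (single x)
  show ?case by (rule exI[of _ "[x]"]) simp
next
  case (step y z m A C x)
  then obtain xs where xs: "length xs = Suc m" "xs ! 0 = y" "xs ! m = z" "distinct xs" "set xs = A"
    "inj_on (\<lambda>i. \<gamma> {xs ! i, xs ! Suc i}) {..<m}" "(\<lambda>i. \<gamma> {xs ! i, xs ! Suc i}) ` {..<m} = C"
    by blast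
  have im: "(\<lambda>i. \<gamma> {(x # xs) ! i, (x # xs) ! Suc i}) ` {..<Suc m} = insert (\<gamma> {x, y}) C"
    unfolding lessThan_Suc_eq_insert_0 using xs(2,7) by (simp add: image_image)
  moreover have "inj_on (\<lambda>i. \<gamma> {(x # xs) ! i, (x # xs) ! Suc i}) (Suc ` {..<m})"
    using xs(6) by (intro inj_on_imageI) (simp add: o_def)
  then have "inj_on (\<lambda>i. \<gamma> {(x # xs) ! i, (x # xs) ! Suc i}) {..<Suc m}"
    unfolding lessThan_Suc_eq_insert_0 using xs(2,7) step(3)
    by (simp add: image_image Diff_triv)
  ultimately show ?case
    using xs step(2) by (intro exI[of _ "x # xs"]) simp
qed

lemma rpath_close:
  assumes p: "rpath \<gamma> x y m A C" and "A \<subseteq> V" and cl: "\<gamma> {y, x} \<notin> C" and m: "m \<ge> 1"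
  shows "Suc m \<notin> spec V (nsets V 2) \<gamma>"
proof -
  obtain xs where xs: "length xs = Suc m" "xs ! 0 = x" "xs ! m = y" "distinct xs" "set xs = A"
    "inj_on (\<lambda>i. \<gamma> {xs ! i, xs ! Suc i}) {..<m}" "(\<lambda>i. \<gamma> {xs ! i, xs ! Suc i}) ` {..<m} = C"
    using rpath_list[OF p] by blast
  have ce: "cycle_edge xs i = (if i = m then {y, x} else {xs ! i, xs ! Suc i})" if "i < Suc m" for i
    using that xs by (auto simp: cycle_edge_def)
  have "cycle_edge xs i \<in> nsets V 2" if i: "i < Suc m" for i
  proof -
    have "Suc i mod Suc m < Suc m" "Suc i mod Suc m \<noteq> i"
      using i m by (auto simp: mod_Suc)
    then have "xs ! i \<noteq> xs ! (Suc i mod Suc m)" "xs ! i \<in> V" "xs ! (Suc i mod Suc m) \<in> V"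
      using xs i \<open>A \<subseteq> V\<close> by (auto simp: nth_eq_iff_index_eq)
    then show ?thesis by (simp add: cycle_edge_def xs nsets_def)
  qed
  then have "is_cycle V (nsets V 2) (Suc m) xs"
    using xs \<open>A \<subseteq> V\<close> m by (simp add: is_cycle_def)
  moreover have "rainbow \<gamma> xs"
  proof -
    have "inj_on (\<lambda>i. \<gamma> (cycle_edge xs i)) (insert m {..<m})"
      using xs cl inj_on_cong[of "{..<m}" "\<lambda>i. \<gamma> (cycle_edge xs i)" "\<lambda>i. \<gamma> {xs ! i, xs ! Suc i}"]
        image_cong[of "{..<m}" "{..<m}" "\<lambda>i. \<gamma> (cycle_edge xs i)" "\<lambda>i. \<gamma> {xs ! i, xs ! Suc i}"]
      by (simp add: ce)
    then show ?thesis by (simp add: rainbow_def xs lessThan_Suc)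
  qed
  ultimately show ?thesis by (auto simp: spec_def)
qed

text \<open>Indices range over all integers, so a walk may pass the starting point without case
  distinctions.\<close>

locale rainbow_cycle =
  fixes V :: "'a set" and \<gamma> :: "'a set \<Rightarrow> 'c" and L :: int and v :: "int \<Rightarrow> 'a"
  assumes L3: "L \<ge> 3"
    and inV: "v i \<in> V"
    and v_eq: "v i = v j \<longleftrightarrow> i mod L = j mod L"
    and edge_eq': "\<gamma> {v i, v (i + 1)} = \<gamma> {v j, v (j + 1)} \<longleftrightarrow> i mod L = j mod L"
begin

definition col :: "int \<Rightarrow> int \<Rightarrow> 'c" where "col i j = \<gamma> {v i, v j}"

definition edge :: "int \<Rightarrow> 'c" where "edge i = col i (i + 1)"

text \<open>Lengths are integers here, so that differences such as \<open>L - 2 * m\<close> need no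
  truncated subtraction.\<close>

definition sp :: "int \<Rightarrow> bool" where "sp m \<longleftrightarrow> nat m \<in> spec V (nsets V 2) \<gamma>"

lemma edge_eq: "edge i = edge j \<longleftrightarrow> i mod L = j mod L"
  using edge_eq' by (simp add: edge_def col_def)

lemma col_sym: "col i j = col j i"
  by (simp add: col_def insert_commute)

lemma mod_eq_near: "i mod L = j mod L \<Longrightarrow> \<bar>i - j\<bar> < L \<Longrightarrow> i = j" for i j :: int
  using dvd_imp_le_int[of "i - j" L] L3 by (auto simp: mod_eq_dvd_iff)

lemma edge_near: "\<bar>i - j\<bar> < L \<Longrightarrow> edge i = edge j \<longleftrightarrow> i = j"
  using mod_eq_near edge_eq by auto

lemma edge_window: "u \<le> i \<Longrightarrow> i < u + L \<Longrightarrow> u \<le> j \<Longrightarrow> j < u + L \<Longrightarrow> edge i = edge j \<longleftrightarrow> i = j"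
  by (rule edge_near) linarith

lemma v_near: "\<bar>i - j\<bar> < L \<Longrightarrow> v i = v j \<longleftrightarrow> i = j"
  using mod_eq_near v_eq by auto

lemma v_shift [simp]: "v (i + L) = v i"
  by (simp add: v_eq)

lemma edge_shift [simp]: "edge (i + L) = edge i"
  by (simp add: edge_eq)

lemma col_shift: "col (i + L) j = col i j" "col i (j + L) = col i j"
  by (simp_all add: col_def)

text \<open>
  Vertices and edges are indexed modulo \<open>L\<close>. Disjointness of paths is therefore read off index sets
  contained in a window of length \<open>L\<close>, chosen separately for vertices (\<open>s\<close>) and edges (\<open>u\<close>).
\<close>

definition arc :: "int \<Rightarrow> int \<Rightarrow> int \<Rightarrow> int \<Rightarrow> nat \<Rightarrow> int set \<Rightarrow> int set \<Rightarrow> bool" where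
  "arc s u x y m P Q \<longleftrightarrow> rpath \<gamma> (v x) (v y) m (v ` P) (edge ` Q) \<and> P \<subseteq> {s..<s + L} \<and> Q \<subseteq> {u..<u + L}"

lemma v_disj: "P \<subseteq> {s..<s + L} \<Longrightarrow> P' \<subseteq> {s..<s + L} \<Longrightarrow> P \<inter> P' = {} \<Longrightarrow> v ` P \<inter> v ` P' = {}"
proof -
  assume *: "P \<subseteq> {s..<s + L}" "P' \<subseteq> {s..<s + L}" "P \<inter> P' = {}"
  have "v p \<noteq> v p'" if "p \<in> P" "p' \<in> P'" for p p'
  proof -
    have "\<bar>p - p'\<bar> < L" "p \<noteq> p'" using * that by force+
    then show ?thesis by (simp add: v_near)
  qed
  then show ?thesis by auto
qed

lemma edge_disj: "Q \<subseteq> {u..<u + L} \<Longrightarrow> Q' \<subseteq> {u..<u + L} \<Longrightarrow> Q \<inter> Q' = {} \<Longrightarrow> edge ` Q \<inter> edge ` Q' = {}"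
proof -
  assume *: "Q \<subseteq> {u..<u + L}" "Q' \<subseteq> {u..<u + L}" "Q \<inter> Q' = {}"
  have "edge q \<noteq> edge q'" if "q \<in> Q" "q' \<in> Q'" for q q'
  proof -
    have "\<bar>q - q'\<bar> < L" "q \<noteq> q'" using * that by force+
    then show ?thesis by (simp add: edge_near)
  qed
  then show ?thesis by auto
qed

lemma edge_mem: "Q \<subseteq> {u..<u + L} \<Longrightarrow> q \<in> {u..<u + L} \<Longrightarrow> edge q \<in> edge ` Q \<longleftrightarrow> q \<in> Q"
  using edge_disj[of Q u "{q}"] by auto

lemma arc_single: "x \<in> {s..<s + L} \<Longrightarrow> arc s u x x 0 {x} {}"
  using rpath.single by (simp add: arc_def)

lemma arc_rev: "arc s u x y m P Q \<Longrightarrow> arc s u y x m P Q"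
  by (simp add: arc_def rpath_rev)

lemma arc_link:
  assumes "arc s u x y m P Q" "arc s u y' z k P' Q'"
    and "P \<inter> P' = {}" "Q \<inter> Q' = {}" "col y y' = edge q" "q \<in> {u..<u + L}" "q \<notin> Q \<union> Q'"
  shows "arc s u x z (m + k + 1) (P \<union> P') (insert q (Q \<union> Q'))"
proof -
  have "rpath \<gamma> (v x) (v z) (m + k + 1) (v ` P \<union> v ` P')
      (insert (\<gamma> {v y, v y'}) (edge ` Q \<union> edge ` Q'))"
  proof (rule rpath_link)
    have "edge q \<notin> edge ` (Q \<union> Q')"
      using assms edge_mem[of "Q \<union> Q'" u q] by (auto simp: arc_def)
    then show "\<gamma> {v y, v y'} \<notin> edge ` Q \<union> edge ` Q'"
      using assms(5) by (auto simp: col_def)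
    show "v ` P \<inter> v ` P' = {}" "edge ` Q \<inter> edge ` Q' = {}"
      using assms(1-4) v_disj[of P s P'] edge_disj[of Q u Q'] by (simp_all add: arc_def)
  qed (use assms in \<open>simp_all add: arc_def\<close>)
  then show ?thesis
    using assms by (auto simp: arc_def col_def image_Un)
qed

lemma arc_up: "a \<le> b \<Longrightarrow> {a..b} \<subseteq> {s..<s + L} \<Longrightarrow> {a..<b} \<subseteq> {u..<u + L} \<Longrightarrow>
  arc s u a b (nat (b - a)) {a..b} {a..<b}"
proof (induction b rule: int_ge_induct)
  case base
  then show ?case using arc_single by simp
next
  case (step b)
  have "arc s u a (b + 1) (nat (b - a) + 0 + 1) ({a..b} \<union> {b + 1}) (insert b ({a..<b} \<union> {}))"
  proof (rule arc_link)
    show "arc s u a b (nat (b - a)) {a..b} {a..<b}"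
    proof (rule step.IH)
      show "{a..b} \<subseteq> {s..<s + L}"
        using step.prems(1) by (rule subset_trans[rotated]) auto
      show "{a..<b} \<subseteq> {u..<u + L}"
        using step.prems(2) by (rule subset_trans[rotated]) auto
    qed
    show "arc s u (b + 1) (b + 1) 0 {b + 1} {}"
      using step.hyps step.prems(1) subsetD[OF step.prems(1), of "b + 1"] by (intro arc_single) auto
  qed (use step in \<open>auto simp: edge_def\<close>)
  moreover have "{a..b} \<union> {b + 1} = {a..b + 1}" "insert b ({a..<b} \<union> {}) = {a..<b + 1}"
    "nat (b - a) + 0 + 1 = nat (b + 1 - a)"
    using step by auto
  ultimately show ?case by metis
qed

lemma arc_close:
  assumes "arc s u x y m P Q" "col y x \<notin> edge ` Q" "m \<ge> 1" "n = int m + 1"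
  shows "\<not> sp n"
proof -
  have "Suc m \<notin> spec V (nsets V 2) \<gamma>"
    using assms inV by (intro rpath_close) (auto simp: arc_def col_def)
  then show ?thesis using assms by (simp add: sp_def nat_add_distrib)
qed

text \<open>A segment is a run of consecutive vertices with ends \<open>l \<le> h\<close>, entered at \<open>a\<close> and left at \<open>b\<close>.\<close>

definition seg :: "int \<Rightarrow> int \<Rightarrow> int \<Rightarrow> int \<Rightarrow> int \<Rightarrow> int \<Rightarrow> bool" where
  "seg s u a b l h \<longleftrightarrow> l \<le> h \<and> (a = l \<and> b = h \<or> a = h \<and> b = l) \<and> s \<le> l \<and> h < s + L
     \<and> (l < h \<longrightarrow> u \<le> l \<and> h \<le> u + L)"

lemma seg_le: "seg s u a b l h \<Longrightarrow> l \<le> h"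
  by (simp add: seg_def)

lemma seg_color: "seg s u a b l h \<Longrightarrow> l \<le> j \<Longrightarrow> j < h \<Longrightarrow> u \<le> j \<and> j < u + L"
  by (auto simp: seg_def)

lemma seg_arc: "seg s u a b l h \<Longrightarrow> arc s u a b (nat (h - l)) {l..h} {l..<h}"
  using arc_up[of l h s u] arc_rev[of s u l h] unfolding seg_def by fastforce

section \<open>Cycles assembled from segments and chords\<close>

lemma arc_link_segs:
  assumes "seg s u a1 b1 l1 h1" "seg s u a2 b2 l2 h2"
    and "h1 < l2 \<or> h2 < l1"
    and "col b1 a2 = edge q1" "u \<le> q1" "q1 < u + L" "q1 < l1 \<or> h1 \<le> q1" "q1 < l2 \<or> h2 \<le> q1"
  shows "arc s u a1 b2 (nat (h1 - l1) + nat (h2 - l2) + 1) ({l1..h1} \<union> {l2..h2})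
      (insert q1 ({l1..<h1} \<union> {l2..<h2}))"
proof (rule arc_link[OF seg_arc[OF assms(1)] seg_arc[OF assms(2)]])
  show "{l1..h1} \<inter> {l2..h2} = {}" "{l1..<h1} \<inter> {l2..<h2} = {}"
    using assms(3) by auto
qed (use assms in auto)

text \<open>The closing chord may have any color new to the path. Contraposed, an excluded
  \<open>n\<close> restricts the color of that chord.\<close>

lemma cycle2:
  assumes "col b1 a2 = edge q1"
    and new: "\<And>j. j = q1 \<or> l1 \<le> j \<and> j < h1 \<or> l2 \<le> j \<and> j < h2 \<Longrightarrow> col b2 a1 \<noteq> edge j"
    and seg: "seg s u a1 b1 l1 h1" "seg s u a2 b2 l2 h2"
    and "h1 < l2 \<or> h2 < l1" "u \<le> q1" "q1 < u + L" "q1 < l1 \<or> h1 \<le> q1" "q1 < l2 \<or> h2 \<le> q1"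
    and n: "n = (h1 - l1) + (h2 - l2) + 2"
  shows "\<not> sp n"
proof -
  have "arc s u a1 b2 (nat (h1 - l1) + nat (h2 - l2) + 1) ({l1..h1} \<union> {l2..h2})
      (insert q1 ({l1..<h1} \<union> {l2..<h2}))"
    by (rule arc_link_segs[OF seg assms(5,1,6-9)])
  then show ?thesis
  proof (rule arc_close)
    have "col b2 a1 \<noteq> edge j" if "j \<in> insert q1 ({l1..<h1} \<union> {l2..<h2})" for j
      using that by (intro new) auto
    then show "col b2 a1 \<notin> edge ` insert q1 ({l1..<h1} \<union> {l2..<h2})"
      by (metis imageE)
  qed (use seg_le[OF seg(1)] seg_le[OF seg(2)] n in simp_all)
qed

text \<open>That the color of a link is not repeated on a segment is phrased by inequalities between
  indices, so each use is a matter of linear arithmetic. \<open>cycle3\<close> and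
  \<open>cycle4\<close> have the same form.\<close>

lemma cycle2_edge:
  assumes "col b1 a2 = edge q1" "col b2 a1 = edge q2"
    and seg: "seg s u a1 b1 l1 h1" "seg s u a2 b2 l2 h2"
    and "h1 < l2 \<or> h2 < l1"
    and q1: "u \<le> q1" "q1 < u + L" "q1 < l1 \<or> h1 \<le> q1" "q1 < l2 \<or> h2 \<le> q1"
    and q2: "u \<le> q2" "q2 < u + L" "q2 < l1 \<or> h1 \<le> q2" "q2 < l2 \<or> h2 \<le> q2"
    and "q1 \<noteq> q2"
    and "n = (h1 - l1) + (h2 - l2) + 2"
  shows "\<not> sp n"
proof (rule cycle2[OF assms(1) _ seg assms(5) q1])
  fix j assume j: "j = q1 \<or> l1 \<le> j \<and> j < h1 \<or> l2 \<le> j \<and> j < h2"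
  have "u \<le> j" "j < u + L"
    using j q1(1,2) seg_color[OF seg(1)] seg_color[OF seg(2)] by blast+
  moreover have "q2 \<noteq> j"
    using j q2(3,4) \<open>q1 \<noteq> q2\<close> by linarith
  ultimately show "col b2 a1 \<noteq> edge j"
    using assms(2) q2(1,2) edge_window[of u q2 j] by simp
qed (rule assms)

lemma cycle3:
  assumes "col b1 a2 = edge q1" "col b2 a3 = edge q2" "col b3 a1 = edge q3"
    and seg: "seg s u a1 b1 l1 h1" "seg s u a2 b2 l2 h2" "seg s u a3 b3 l3 h3"
    and disj: "h1 < l2 \<or> h2 < l1" "h1 < l3 \<or> h3 < l1" "h3 < l2 \<or> h2 < l3"
    and q1: "u \<le> q1" "q1 < u + L" "q1 < l1 \<or> h1 \<le> q1" "q1 < l2 \<or> h2 \<le> q1" "q1 < l3 \<or> h3 \<le> q1"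
    and q2: "u \<le> q2" "q2 < u + L" "q2 < l1 \<or> h1 \<le> q2" "q2 < l2 \<or> h2 \<le> q2" "q2 < l3 \<or> h3 \<le> q2"
    and q3: "u \<le> q3" "q3 < u + L" "q3 < l1 \<or> h1 \<le> q3" "q3 < l2 \<or> h2 \<le> q3" "q3 < l3 \<or> h3 \<le> q3"
    and ne: "q1 \<noteq> q2" "q1 \<noteq> q3" "q2 \<noteq> q3"
    and n: "n = (h1 - l1) + (h2 - l2) + (h3 - l3) + 3"
  shows "\<not> sp n"
proof -
  have "arc s u a1 b2 (nat (h1 - l1) + nat (h2 - l2) + 1) ({l1..h1} \<union> {l2..h2})
      (insert q1 ({l1..<h1} \<union> {l2..<h2}))"
    by (rule arc_link_segs[OF seg(1,2) disj(1) assms(1) q1(1-4)])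
  then have "arc s u a1 b3 (nat (h1 - l1) + nat (h2 - l2) + 1 + nat (h3 - l3) + 1)
      ({l1..h1} \<union> {l2..h2} \<union> {l3..h3}) (insert q2 (insert q1 ({l1..<h1} \<union> {l2..<h2}) \<union> {l3..<h3}))"
  proof (rule arc_link[OF _ seg_arc[OF seg(3)]])
    have "{l1..h1} \<inter> {l3..h3} = {}" "{l2..h2} \<inter> {l3..h3} = {}"
      "{l1..<h1} \<inter> {l3..<h3} = {}" "{l2..<h2} \<inter> {l3..<h3} = {}" "q1 \<notin> {l3..<h3}"
      using disj(2,3) q1(5) by auto
    then show "({l1..h1} \<union> {l2..h2}) \<inter> {l3..h3} = {}"
      "insert q1 ({l1..<h1} \<union> {l2..<h2}) \<inter> {l3..<h3} = {}"
      by blast+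
  qed (use assms(2) q2 ne in auto)
  then show ?thesis
  proof (rule arc_close)
    have "col b3 a1 \<noteq> edge j" if "j \<in> insert q2 (insert q1 ({l1..<h1} \<union> {l2..<h2}) \<union> {l3..<h3})" for j
    proof -
      have "j = q1 \<or> j = q2 \<or> l1 \<le> j \<and> j < h1 \<or> l2 \<le> j \<and> j < h2 \<or> l3 \<le> j \<and> j < h3"
        using that by auto
      then have "u \<le> j" "j < u + L" "q3 \<noteq> j"
        using q1(1,2) q2(1,2) seg_color[OF seg(1)] seg_color[OF seg(2)] seg_color[OF seg(3)]
          q3(3-5) ne by (metis not_le)+
      then show ?thesis
        using assms(3) q3(1,2) edge_window[of u q3 j] by simp
    qed
    then show "col b3 a1 \<notin> edge ` insert q2 (insert q1 ({l1..<h1} \<union> {l2..<h2}) \<union> {l3..<h3})"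
      by (metis imageE)
  qed (use seg_le[OF seg(1)] seg_le[OF seg(2)] seg_le[OF seg(3)] n in simp_all)
qed

lemma cycle4:
  assumes "col b1 a2 = edge q1" "col b2 a3 = edge q2" "col b3 a4 = edge q3" "col b4 a1 = edge q4"
    and seg: "seg s u a1 b1 l1 h1" "seg s u a2 b2 l2 h2" "seg s u a3 b3 l3 h3" "seg s u a4 b4 l4 h4"
    and disj: "h1 < l2 \<or> h2 < l1" "h1 < l3 \<or> h3 < l1" "h3 < l2 \<or> h2 < l3"
      "h1 < l4 \<or> h4 < l1" "h4 < l2 \<or> h2 < l4" "h4 < l3 \<or> h3 < l4"
    and q1: "u \<le> q1" "q1 < u + L" "q1 < l1 \<or> h1 \<le> q1" "q1 < l2 \<or> h2 \<le> q1" "q1 < l3 \<or> h3 \<le> q1" "q1 < l4 \<or> h4 \<le> q1"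
    and q2: "u \<le> q2" "q2 < u + L" "q2 < l1 \<or> h1 \<le> q2" "q2 < l2 \<or> h2 \<le> q2" "q2 < l3 \<or> h3 \<le> q2" "q2 < l4 \<or> h4 \<le> q2"
    and q3: "u \<le> q3" "q3 < u + L" "q3 < l1 \<or> h1 \<le> q3" "q3 < l2 \<or> h2 \<le> q3" "q3 < l3 \<or> h3 \<le> q3" "q3 < l4 \<or> h4 \<le> q3"
    and q4: "u \<le> q4" "q4 < u + L" "q4 < l1 \<or> h1 \<le> q4" "q4 < l2 \<or> h2 \<le> q4" "q4 < l3 \<or> h3 \<le> q4" "q4 < l4 \<or> h4 \<le> q4"
    and ne: "q1 \<noteq> q2" "q1 \<noteq> q3" "q2 \<noteq> q3" "q1 \<noteq> q4" "q2 \<noteq> q4" "q3 \<noteq> q4"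
    and n: "n = (h1 - l1) + (h2 - l2) + (h3 - l3) + (h4 - l4) + 4"
  shows "\<not> sp n"
proof -
  have "arc s u a1 b2 (nat (h1 - l1) + nat (h2 - l2) + 1) ({l1..h1} \<union> {l2..h2})
      (insert q1 ({l1..<h1} \<union> {l2..<h2}))"
    by (rule arc_link_segs[OF seg(1,2) disj(1) assms(1) q1(1-4)])
  moreover have "arc s u a3 b4 (nat (h3 - l3) + nat (h4 - l4) + 1) ({l3..h3} \<union> {l4..h4})
      (insert q3 ({l3..<h3} \<union> {l4..<h4}))"
    by (rule arc_link_segs[OF seg(3,4) _ assms(3) q3(1,2,5,6)]) (use disj(6) in auto)
  ultimately have "arc s u a1 b4 (nat (h1 - l1) + nat (h2 - l2) + 1 + (nat (h3 - l3) + nat (h4 - l4) + 1) + 1)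
      ({l1..h1} \<union> {l2..h2} \<union> ({l3..h3} \<union> {l4..h4}))
      (insert q2 (insert q1 ({l1..<h1} \<union> {l2..<h2}) \<union> insert q3 ({l3..<h3} \<union> {l4..<h4})))"
  proof (rule arc_link)
    have "{l1..h1} \<inter> {l3..h3} = {}" "{l1..<h1} \<inter> {l3..<h3} = {}" using disj(2) by auto
    moreover have "{l2..h2} \<inter> {l3..h3} = {}" "{l2..<h2} \<inter> {l3..<h3} = {}" using disj(3) by auto
    moreover have "{l1..h1} \<inter> {l4..h4} = {}" "{l1..<h1} \<inter> {l4..<h4} = {}" using disj(4) by auto
    moreover have "{l2..h2} \<inter> {l4..h4} = {}" "{l2..<h2} \<inter> {l4..<h4} = {}" using disj(5) by auto
    moreover have "q1 \<notin> {l3..<h3}" "q1 \<notin> {l4..<h4}" using q1(5,6) by auto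
    moreover have "q3 \<notin> {l1..<h1}" "q3 \<notin> {l2..<h2}" using q3(3,4) by auto
    ultimately show "({l1..h1} \<union> {l2..h2}) \<inter> ({l3..h3} \<union> {l4..h4}) = {}"
      "insert q1 ({l1..<h1} \<union> {l2..<h2}) \<inter> insert q3 ({l3..<h3} \<union> {l4..<h4}) = {}"
      using ne(2) by blast+
    have "q2 \<notin> {l1..<h1}" "q2 \<notin> {l2..<h2}" using q2(3,4) by auto
    moreover have "q2 \<notin> {l3..<h3}" "q2 \<notin> {l4..<h4}" using q2(5,6) by auto
    ultimately show "q2 \<notin> insert q1 ({l1..<h1} \<union> {l2..<h2}) \<union> insert q3 ({l3..<h3} \<union> {l4..<h4})"
      using ne(1,3) by blast
    show "q2 \<in> {u..<u + L}" using q2(1,2) by simp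
  qed (rule assms(2))
  then show ?thesis
  proof (rule arc_close)
    let ?Q = "insert q2 (insert q1 ({l1..<h1} \<union> {l2..<h2}) \<union> insert q3 ({l3..<h3} \<union> {l4..<h4}))"
    have "col b4 a1 \<noteq> edge j" if "j \<in> ?Q" for j
    proof -
      have "j = q1 \<or> j = q2 \<or> j = q3 \<or> l1 \<le> j \<and> j < h1 \<or> l2 \<le> j \<and> j < h2 \<or> l3 \<le> j \<and> j < h3 \<or> l4 \<le> j \<and> j < h4"
        using that by auto
      then have "u \<le> j" "j < u + L" "q4 \<noteq> j"
        using q1(1,2) q2(1,2) q3(1,2) seg_color[OF seg(1)] seg_color[OF seg(2)] seg_color[OF seg(3)]
          seg_color[OF seg(4)] q4(3-6) ne by (metis not_le)+
      then show ?thesis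
        using assms(4) q4(1,2) edge_window[of u q4 j] by simp
    qed
    then show "col b4 a1 \<notin> edge ` ?Q" by (metis imageE)
  qed (use seg_le[OF seg(1)] seg_le[OF seg(2)] seg_le[OF seg(3)] seg_le[OF seg(4)] n in simp_all)
qed

text \<open>Otherwise the chord and the \<open>m - 1\<close> edges between its ends would form a
  rainbow cycle of the excluded length.\<close>

lemma chord_color:
  assumes "sp m" "m = j - i + 1" "i < j" "j < i + L"
  shows "\<exists>q. i \<le> q \<and> q < j \<and> col i j = edge q"
proof (rule ccontr)
  assume "\<not> ?thesis"
  then have "col j i \<notin> edge ` {i..<j}"
    unfolding col_sym[of j i] by force
  then have "\<not> sp m"
    using assms by (intro arc_close[OF arc_up[of i j i i]]) auto
  then show False using assms by simp
qed

lemma reverse: "rainbow_cycle V \<gamma> L (\<lambda>i. v (- i))"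
proof
  have *: "(- i) mod L = (- j) mod L \<longleftrightarrow> i mod L = j mod L" for i j
    by (simp add: mod_eq_dvd_iff dvd_diff_commute)
  show "v (- i) = v (- j) \<longleftrightarrow> i mod L = j mod L" for i j
    by (simp add: v_eq *)
  have "\<gamma> {v (- i), v (- (i + 1))} = edge (- i - 1)" for i
    by (simp add: edge_def col_def insert_commute)
  moreover have "(- i - 1) mod L = (- j - 1) mod L \<longleftrightarrow> i mod L = j mod L" for i j
    by (simp add: mod_eq_dvd_iff dvd_diff_commute)
  ultimately show "\<gamma> {v (- i), v (- (i + 1))} = \<gamma> {v (- j), v (- (j + 1))} \<longleftrightarrow> i mod L = j mod L" for i j
    by (simp add: edge_eq)
qed (use L3 inV in auto)

lemma rotate: "rainbow_cycle V \<gamma> L (\<lambda>i. v (i + k))"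
proof
  have *: "(i + k) mod L = (j + k) mod L \<longleftrightarrow> i mod L = j mod L" for i j
    by (simp add: mod_eq_dvd_iff)
  show "v (i + k) = v (j + k) \<longleftrightarrow> i mod L = j mod L" for i j
    by (simp add: v_eq *)
  have "\<gamma> {v (i + k), v (i + 1 + k)} = edge (i + k)" for i
    by (simp add: edge_def col_def add_ac)
  then show "\<gamma> {v (i + k), v (i + 1 + k)} = \<gamma> {v (j + k), v (j + 1 + k)} \<longleftrightarrow> i mod L = j mod L" for i j
    by (simp add: edge_eq *)
qed (use L3 inV in auto)

text \<open>Reducing indices modulo \<open>M\<close> makes the step from \<open>M - 1\<close> to
  \<open>0\<close> traverse the chord, whose color is new; all other steps keep their edges.\<close>

lemma subcycle:
  assumes M: "3 \<le> M" "M \<le> L" and new: "col (M - 1) 0 \<notin> edge ` {0..<M - 1}"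
  shows "rainbow_cycle V \<gamma> M (\<lambda>i. v (i mod M))"
proof
  have r: "0 \<le> i mod M" "i mod M < M" for i using M by auto
  show "v (i mod M) = v (j mod M) \<longleftrightarrow> i mod M = j mod M" for i j
  proof (rule v_near)
    show "\<bar>i mod M - j mod M\<bar> < L" using r[of i] r[of j] M by linarith
  qed
  have e: "\<gamma> {v (i mod M), v ((i + 1) mod M)} = (if i mod M = M - 1 then col (M - 1) 0 else edge (i mod M))" for i
  proof (cases "i mod M = M - 1")
    case True
    then have "(i + 1) mod M = 0" using mod_add_left_eq[of i M 1] by simp
    then show ?thesis using True by (simp add: col_def)
  next
    case False
    then have "(i + 1) mod M = i mod M + 1"
      using r[of i] mod_add_left_eq[of i M 1] by (simp add: mod_pos_pos_trivial)
    then show ?thesis using False by (simp add: edge_def col_def)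
  qed
  show "\<gamma> {v (i mod M), v ((i + 1) mod M)} = \<gamma> {v (j mod M), v ((j + 1) mod M)} \<longleftrightarrow> i mod M = j mod M" for i j
  proof -
    have "col (M - 1) 0 \<noteq> edge (k mod M)" if "k mod M \<noteq> M - 1" for k
      using new r[of k] that by force
    moreover have "edge (i mod M) = edge (j mod M) \<longleftrightarrow> i mod M = j mod M"
      by (rule edge_window[of 0]) (use r[of i] r[of j] M in linarith)+
    ultimately show ?thesis unfolding e by metis
  qed
qed (use M inV in auto)

text \<open>The chords span disjoint triples of edges and each takes its color from its own triple,
  so using all of them keeps the cycle rainbow and saves two edges apiece.\<close>

lemma shortcuts:
  assumes short: "\<And>i. 0 \<le> i \<Longrightarrow> i < m \<Longrightarrow> \<exists>q. y + 3 * i \<le> q \<and> q < y + 3 * i + 3 \<and> col (y + 3 * i) (y + 3 * i + 3) = edge q"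
    and m: "0 \<le> m" "3 * m + 2 \<le> L"
  shows "\<not> sp (L - 2 * m)"
proof -
  have "k \<le> m \<Longrightarrow> \<exists>P Q. arc y y y (y + 3 * k) (nat k) P Q \<and> P \<subseteq> {y..y + 3 * k} \<and> Q \<subseteq> {y..<y + 3 * k}" if "0 \<le> k" for k
    using that
  proof (induction k rule: int_ge_induct)
    case base
    then show ?case using arc_single[of y y y] L3 by (intro exI[of _ "{y}"] exI[of _ "{}"]) auto
  next
    case (step k)
    then obtain P Q where PQ: "arc y y y (y + 3 * k) (nat k) P Q" "P \<subseteq> {y..y + 3 * k}" "Q \<subseteq> {y..<y + 3 * k}"
      by auto
    obtain q where q: "y + 3 * k \<le> q" "q < y + 3 * k + 3" "col (y + 3 * k) (y + 3 * k + 3) = edge q"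
      using short[of k] step by auto
    have "arc y y y (y + 3 * k + 3) (nat k + 0 + 1) (P \<union> {y + 3 * k + 3}) (insert q (Q \<union> {}))"
    proof (rule arc_link[OF PQ(1)])
      show "arc y y (y + 3 * k + 3) (y + 3 * k + 3) 0 {y + 3 * k + 3} {}"
        using step m by (intro arc_single) auto
      show "col (y + 3 * k) (y + 3 * k + 3) = edge q" by (rule q)
    qed (use PQ(2,3) q(1,2) step m in auto)
    moreover have "nat k + 0 + 1 = nat (k + 1)" "y + 3 * k + 3 = y + 3 * (k + 1)"
      using step by auto
    ultimately have "arc y y y (y + 3 * (k + 1)) (nat (k + 1)) (P \<union> {y + 3 * k + 3}) (insert q Q)"
      by (metis sup_bot_right)
    then show ?case
      using PQ(2,3) q(1,2) step by (intro exI[of _ "P \<union> {y + 3 * k + 3}"] exI[of _ "insert q Q"]) auto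
  qed
  then obtain P Q where PQ: "arc y y y (y + 3 * m) (nat m) P Q" "P \<subseteq> {y..y + 3 * m}" "Q \<subseteq> {y..<y + 3 * m}"
    using m by blast
  have "arc y y y (y + L - 1) (nat m + nat (y + L - 1 - (y + 3 * m + 1)) + 1)
      (P \<union> {y + 3 * m + 1..y + L - 1}) (insert (y + 3 * m) (Q \<union> {y + 3 * m + 1..<y + L - 1}))"
  proof (rule arc_link[OF PQ(1) arc_up])
    show "P \<inter> {y + 3 * m + 1..y + L - 1} = {}" "Q \<inter> {y + 3 * m + 1..<y + L - 1} = {}"
      using PQ(2,3) by fastforce+
    show "y + 3 * m \<notin> Q \<union> {y + 3 * m + 1..<y + L - 1}"
      using PQ(3) by auto
  qed (use m in \<open>auto simp: edge_def\<close>)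
  then show ?thesis
  proof (rule arc_close)
    let ?Q = "insert (y + 3 * m) (Q \<union> {y + 3 * m + 1..<y + L - 1})"
    have "col (y + L - 1) y = edge (y + L - 1)"
      using col_shift(2)[of "y + L - 1" y] by (simp add: edge_def)
    moreover have "y + L - 1 \<notin> ?Q" "?Q \<subseteq> {y..<y + L}"
      using PQ(3) m by auto
    then have "edge (y + L - 1) \<notin> edge ` ?Q"
      using edge_mem[of ?Q y "y + L - 1"] L3 by auto
    ultimately show "col (y + L - 1) y \<notin> edge ` ?Q" by simp
  qed (use m in auto)
qed

end

section \<open>Additivity of the excluded lengths\<close>

lemma not_spec_rainbow_cycle:
  assumes "m \<notin> spec V (nsets V 2) \<gamma>" "m \<ge> 2"
  obtains v where "rainbow_cycle V \<gamma> (int m) v"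
proof -
  obtain vs where c: "is_cycle V (nsets V 2) m vs" and r: "rainbow \<gamma> vs"
    using assms by (auto simp: spec_def)
  have m: "m \<ge> 3"
    using assms two_in_spec[of V "nsets V 2" \<gamma>] by (cases "m = 2") auto
  define v where "v i = vs ! nat (i mod int m)" for i
  have len: "length vs = m" and d: "distinct vs" and V: "set vs \<subseteq> V"
    using c by (auto simp: is_cycle_def)
  have lt: "nat (i mod int m) < m" for i :: int
    using m by (simp add: nat_less_iff)
  have nat_eq: "nat (i mod int m) = nat (j mod int m) \<longleftrightarrow> i mod int m = j mod int m" for i j :: int
    using m by (simp add: nat_eq_iff)
  have e: "{v i, v (i + 1)} = cycle_edge vs (nat (i mod int m))" for i
  proof -
    have "(i + 1) mod int m = (i mod int m + 1) mod int m"
      by (simp add: mod_add_left_eq)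
    also have "\<dots> = int (Suc (nat (i mod int m)) mod m)"
      using m by (simp add: zmod_int add.commute)
    finally show ?thesis by (simp add: v_def cycle_edge_def len)
  qed
  have "rainbow_cycle V \<gamma> (int m) v"
  proof
    show "v i \<in> V" for i
      using V lt[of i] len by (auto simp: v_def)
    show "v i = v j \<longleftrightarrow> i mod int m = j mod int m" for i j
      using d lt len nat_eq by (simp add: v_def nth_eq_iff_index_eq)
    show "\<gamma> {v i, v (i + 1)} = \<gamma> {v j, v (j + 1)} \<longleftrightarrow> i mod int m = j mod int m" for i j
      unfolding e using r lt[of i] lt[of j] nat_eq[of i j] by (auto simp: rainbow_def len inj_on_def)
  qed (use m in auto)
  then show thesis using that by blast
qed

text \<open>In a rainbow cycle of length \<open>a + b - 2\<close> one chord cuts off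
  \<open>a - 1\<close> edges on one side and \<open>b - 1\<close> on the other. Its color would have
  to occur on both sides.\<close>

lemma spec_add:
  assumes "a \<in> spec V (nsets V 2) \<gamma>" "b \<in> spec V (nsets V 2) \<gamma>"
  shows "a + b - 2 \<in> spec V (nsets V 2) \<gamma>"
proof (rule ccontr)
  have ab: "a \<ge> 2" "b \<ge> 2" using assms by (auto simp: spec_def)
  assume "a + b - 2 \<notin> spec V (nsets V 2) \<gamma>"
  then obtain v where "rainbow_cycle V \<gamma> (int (a + b - 2)) v"
  proof -
    assume *: "a + b - 2 \<notin> spec V (nsets V 2) \<gamma>"
      and that: "\<And>v. rainbow_cycle V \<gamma> (int (a + b - 2)) v \<Longrightarrow> thesis"
    have "a + b - 2 \<ge> 2" using ab by simp
    then show thesis using not_spec_rainbow_cycle that * by metis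
  qed
  then interpret rainbow_cycle V \<gamma> "int (a + b - 2)" v .
  have L: "int (a + b - 2) = int a + int b - 2" using ab by simp
  have sp: "sp (int a)" "sp (int b)" using assms by (simp_all add: sp_def)
  obtain q where q: "0 \<le> q" "q < int a - 1" "col 0 (int a - 1) = edge q"
    using chord_color[OF sp(1), of "int a - 1" 0] ab by (auto simp: L)
  obtain p where p: "int a - 1 \<le> p" "p < int (a + b - 2)" "col (int a - 1) (int (a + b - 2)) = edge p"
    using chord_color[OF sp(2), of "int (a + b - 2)" "int a - 1"] ab unfolding L by auto
  have "edge p = edge q"
    using p(3) q(3) col_sym[of "int a - 1" 0] col_shift(2)[of "int a - 1" 0] by (metis add_0)
  then show False
    using edge_window[of 0 p q] p q by (simp add: L)
qed

lemma spec_multiple: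
  assumes "t + 2 \<in> spec V (nsets V 2) \<gamma>"
  shows "j * t + 2 \<in> spec V (nsets V 2) \<gamma>"
proof (induction j)
  case 0
  show ?case using two_in_spec by (metis add_0 mult_0)
next
  case (Suc j)
  have "t + 2 + (j * t + 2) - 2 = Suc j * t + 2" by simp
  then show ?case using spec_add[OF assms Suc] by metis
qed

section \<open>Chords that close up to excluded lengths\<close>

text \<open>By the bound on \<open>L\<close>, chords of span \<open>2 * t + 1\<close> end before a
  full turn, so a color that they cut off has a unique index.\<close>

locale gap_cycle = rainbow_cycle +
  fixes t :: int
  assumes t3: "t \<ge> 3" and L2t: "L \<ge> 2 * t + 2" and spt: "sp (t + 2)"
begin

lemma sp_multiple: "t dvd m \<Longrightarrow> m \<ge> 0 \<Longrightarrow> sp (m + 2)"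
proof -
  assume "t dvd m" "m \<ge> 0"
  then obtain j where j: "m = t * j" "j \<ge> 0"
    using t3 by (metis dvdE not_less zero_le_mult_iff le_less_trans[of 0 3] less_le_trans zero_less_numeral)
  have "nat j * nat t + 2 \<in> spec V (nsets V 2) \<gamma>"
    using spt t3 by (intro spec_multiple) (simp add: sp_def nat_add_distrib)
  then show ?thesis
    using j t3 by (simp add: sp_def nat_add_distrib nat_mult_distrib mult.commute)
qed

text \<open>Recording the position of the edge with the chord's color, instead of the color, lets
  chords be compared by inequalities.\<close>

definition c1 :: "int \<Rightarrow> int" where
  "c1 i = (SOME q. i \<le> q \<and> q \<le> i + t \<and> col i (i + t + 1) = edge q)"

definition c2 :: "int \<Rightarrow> int" where
  "c2 i = (SOME q. i \<le> q \<and> q \<le> i + 2 * t \<and> col i (i + 2 * t + 1) = edge q)"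

lemma c1: "i \<le> c1 i" "c1 i \<le> i + t" "col i (i + t + 1) = edge (c1 i)"
proof -
  have "\<exists>q. i \<le> q \<and> q \<le> i + t \<and> col i (i + t + 1) = edge q"
    using chord_color[OF spt, of "i + t + 1" i] t3 L2t by auto
  from someI_ex[OF this] show "i \<le> c1 i" "c1 i \<le> i + t" "col i (i + t + 1) = edge (c1 i)"
    by (simp_all add: c1_def)
qed

lemma c2: "i \<le> c2 i" "c2 i \<le> i + 2 * t" "col i (i + 2 * t + 1) = edge (c2 i)"
proof -
  have "sp (2 * t + 2)" using t3 by (intro sp_multiple) auto
  from chord_color[OF this, of "i + 2 * t + 1" i]
  have "\<exists>q. i \<le> q \<and> q \<le> i + 2 * t \<and> col i (i + 2 * t + 1) = edge q"
    using t3 L2t by auto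
  from someI_ex[OF this] show "i \<le> c2 i" "c2 i \<le> i + 2 * t" "col i (i + 2 * t + 1) = edge (c2 i)"
    by (simp_all add: c2_def)
qed

lemma c1_eqI: "i \<le> q \<Longrightarrow> q \<le> i + t \<Longrightarrow> col i (i + t + 1) = edge q \<Longrightarrow> c1 i = q"
  using c1[of i] edge_window[of i "c1 i" q] L2t t3 by auto

lemma c2_eqI: "i \<le> q \<Longrightarrow> q \<le> i + 2 * t \<Longrightarrow> col i (i + 2 * t + 1) = edge q \<Longrightarrow> c2 i = q"
  using c2[of i] edge_window[of i "c2 i" q] L2t t3 by auto

lemma c1_shift: "c1 (i + L) = c1 i + L"
proof (rule c1_eqI)
  have "col (i + L) (i + L + t + 1) = col (i + L) (i + t + 1 + L)"
    by (simp add: algebra_simps)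
  then show "col (i + L) (i + L + t + 1) = edge (c1 i + L)"
    by (simp only: col_shift edge_shift c1)
qed (use c1[of i] in auto)

lemma c2_shift: "c2 (i + L) = c2 i + L"
proof (rule c2_eqI)
  have "col (i + L) (i + L + 2 * t + 1) = col (i + L) (i + 2 * t + 1 + L)"
    by (simp add: algebra_simps)
  then show "col (i + L) (i + L + 2 * t + 1) = edge (c2 i + L)"
    by (simp only: col_shift edge_shift c2)
qed (use c2[of i] in auto)

text \<open>The two chords and the \<open>t\<close> edges below the long but not below the short one
  close up to \<open>t + 2\<close> edges. The color of the long chord is on none of these edges, so
  the short chord must repeat it.\<close>

lemma c1_c2:
  assumes "i \<le> k" "k \<le> i + t" "k \<le> c2 i" "c2 i \<le> k + t"
  shows "c1 k = c2 i"
proof (rule ccontr)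
  assume ne: "c1 k \<noteq> c2 i"
  have "\<not> sp (t + 2)"
    by (rule cycle2_edge[OF c1(3)[of k] c2(3)[of i, unfolded col_sym[of i]], where s = i and u = i
          and ?l1.0 = i and ?h1.0 = k and ?l2.0 = "k + t + 1" and ?h2.0 = "i + 2 * t + 1"])
      (use assms ne c1(1,2)[of k] c2(1,2)[of i] L2t t3 in \<open>simp_all add: seg_def\<close>)
  then show False using spt by simp
qed

end

section \<open>Lengths divisible by \<open>t\<close>\<close>

locale block_cycle = gap_cycle +
  assumes tL: "t dvd L" and L3t: "L \<ge> 3 * t"
begin

text \<open>Uses the walk \<open>k - t \<rightarrow> k + 1 \<rightarrow> k \<rightarrow> k + t + 1 \<rightarrow> \<dots>\<close> once around the cycle, with a single step backward.\<close>

lemma turn: "c1 (k - t) = k \<or> c1 k = k"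
proof (rule ccontr)
  assume ne: "\<not> ?thesis"
  define i where "i = k - t"
  \<comment> \<open>Divisibility by \<open>t\<close> enters here: the last chord, over the rest of
    the cycle, has a color that it cuts off.\<close>
  have "sp (L - 3 * t + 2)" using tL L3t by (intro sp_multiple) auto
  from chord_color[OF this, of "i + L - t + 2" "i + 2 * t + 1"]
  obtain q where q: "i + 2 * t + 1 \<le> q" "q \<le> i + L - t + 1" "col (i + 2 * t + 1) (i + L - t + 2) = edge q"
    using t3 L3t by auto
  have "i + t + t + 1 = i + 2 * t + 1" by simp
  then have c: "col (i + L) (i + t + 1) = edge (c1 i)" "col (i + t) (i + 2 * t + 1) = edge (c1 (i + t))"
    using c1(3)[of i] c1(3)[of "i + t"] by (simp_all only: col_shift)
  have ne': "c1 i \<noteq> i + t" "c1 (i + t) \<noteq> i + t"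
    using ne by (simp_all add: i_def)
  have "\<not> sp (t + 2)"
    by (rule cycle3[OF c q(3), where s = "i + 1" and u = i
        and ?l1.0 = "i + L - t + 2" and ?h1.0 = "i + L" and ?l2.0 = "i + t" and ?h2.0 = "i + t + 1"
        and ?l3.0 = "i + 2 * t + 1" and ?h3.0 = "i + 2 * t + 1"])
      (use c1(1,2)[of i] c1(1,2)[of "i + t"] q(1,2) ne' L3t t3 in \<open>auto simp: seg_def\<close>)
  then show False using spt by simp
qed

text \<open>By \<open>c1_X\<close>, if not \<open>X k\<close> then the chord leaving \<open>k\<close> has the color of the last edge that it cuts off.\<close>

definition X :: "int \<Rightarrow> bool" where "X k \<longleftrightarrow> c1 k = k"

lemma X_add: "X k \<Longrightarrow> X (k + t)"
  using turn[of "k + t"] t3 by (auto simp: X_def)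

lemma X_add_nat: "X k \<Longrightarrow> X (k + int m * t)"
proof (induction m)
  case (Suc m)
  then show ?case using X_add[of "k + int m * t"] by (simp add: algebra_simps)
qed simp

lemma X_add_L: "X (k + L) \<longleftrightarrow> X k"
  by (simp add: X_def c1_shift)

text \<open>\<open>X\<close> propagates by steps of \<open>t\<close>, and \<open>L div t\<close>
  such steps return to the start modulo \<open>L\<close>.\<close>

lemma X_period: "X (k + t) \<longleftrightarrow> X k"
proof
  assume "X (k + t)"
  obtain j where j: "L = t * j" using tL by blast
  then have "j \<ge> 3" using L3t t3 by (simp add: mult.commute)
  then have "k + t + int (nat (j - 1)) * t = k + L"
    by (simp add: j algebra_simps)
  then show "X k" using X_add_nat[OF \<open>X (k + t)\<close>, of "nat (j - 1)"] X_add_L[of k] by metis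
qed (rule X_add)

lemma X_period': "X (k - t) \<longleftrightarrow> X k"
  using X_period[of "k - t"] by simp

lemma c1_X: "c1 k = (if X k then k else k + t)"
  using turn[of "k + t"] X_period[of k] by (auto simp: X_def)

text \<open>Whichever half contains the color, \<open>c1_c2\<close> transfers it to a short chord.
  The middle value \<open>k + t\<close> would belong to both short chords and give \<open>X\<close>
  at \<open>k + t\<close> but not at \<open>k\<close>.\<close>

lemma c2_X: "c2 k = (if X k then k else k + 2 * t)"
proof (cases "c2 k \<le> k + t")
  case True
  then have "c1 k = c2 k" using c1_c2[of k k] c2[of k] t3 by simp
  moreover have "c1 (k + t) = c2 k" if "c2 k = k + t"
    using c1_c2[of k "k + t"] that t3 by simp
  ultimately show ?thesis
    using c1_X[of k] c1_X[of "k + t"] X_period[of k] t3 True by (auto split: if_splits)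
next
  case False
  then have "c1 (k + t) = c2 k" using c1_c2[of k "k + t"] c2[of k] t3 by simp
  then show ?thesis
    using c1_X[of "k + t"] X_period[of k] False by auto
qed

text \<open>The candidate colors of a chord of span 3 are read off two cycles that share few edges.\<close>

lemma chord3_X:
  assumes "X (y + 1)"
  shows "col y (y + 3) \<in> {edge y, edge (y + 1)} \<or> (col y (y + 3) = edge (y + 3) \<and> X (y + 3))"
proof (rule ccontr)
  assume ne: "\<not> ?thesis"
  have c: "col (y + 1) (y + t + 2) = edge (y + 1)" "col (y + 1) (y + 2 * t + 2) = edge (y + 1)"
      "col (y + t + 4) (y + 3) = edge (c1 (y + 3))"
    using c1(3)[of "y + 1"] c2(3)[of "y + 1"] c1(3)[of "y + 3"] assms c1_X[of "y + 1"] c2_X[of "y + 1"]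
      col_sym[of "y + t + 4" "y + 3"] by (simp_all add: algebra_simps)
  have cl: "col (y + 3) y = col y (y + 3)" by (rule col_sym)
  \<comment> \<open>First cycle: \<open>y\<close>, \<open>y + 1\<close>, \<open>y + t + 2\<close>,
    down to \<open>y + 3\<close> and back to \<open>y\<close>.\<close>
  have "\<exists>j\<in>{y + 3..<y + t + 2}. col y (y + 3) = edge j"
  proof (rule ccontr)
    assume "\<not> ?thesis"
    then have "\<not> sp (t + 2)"
    proof (intro cycle2[OF c(1), of y "y + 1" "y + 3" "y + t + 2" "y + 3" y y y])
      fix j assume "j = y + 1 \<or> y \<le> j \<and> j < y + 1 \<or> y + 3 \<le> j \<and> j < y + t + 2"
      then have "j = y \<or> j = y + 1 \<or> j \<in> {y + 3..<y + t + 2}" by auto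
      then show "col (y + 3) y \<noteq> edge j"
        using ne \<open>\<not> (\<exists>j\<in>_. _)\<close> unfolding cl by blast
    qed (use L3t t3 in \<open>simp_all add: seg_def\<close>)
    then show False using spt by simp
  qed
  then obtain j where j: "y + 3 \<le> j" "j < y + t + 2" "col y (y + 3) = edge j" by auto
  have jne: "j \<noteq> c1 (y + 3)"
    using ne j c1_X[of "y + 3"] by auto
  have c3: "c1 (y + 3) = y + 3 \<or> c1 (y + 3) = y + t + 3"
    using c1_X[of "y + 3"] by auto
  \<comment> \<open>Second cycle: \<open>y\<close>, \<open>y + 1\<close>,
    \<open>y + 2 * t + 2\<close>, down to \<open>y + t + 4\<close>, then \<open>y + 3\<close> and
    back. Besides edges \<open>y\<close> and \<open>y + 1\<close>, its colors meet those of the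
    first cycle at most in edge \<open>y + 3\<close>, and only if \<open>X (y + 3)\<close>.\<close>
  have "\<not> sp (t + 2)"
    by (rule cycle3[OF c(2,3) j(3)[folded cl], where s = y and u = y and ?l1.0 = y and ?h1.0 = "y + 1"
        and ?l2.0 = "y + t + 4" and ?h2.0 = "y + 2 * t + 2" and ?l3.0 = "y + 3" and ?h3.0 = "y + 3"])
      (use j(1,2) jne c3 L3t t3 in \<open>auto simp: seg_def\<close>)
  then show False using spt by simp
qed

text \<open>Mirror image of \<open>chord3_X\<close>: the chords of span \<open>t + 1\<close> and
  \<open>2 * t + 1\<close> that end at \<open>y + 2\<close> both have the color of edge
  \<open>y + 1\<close>.\<close>

lemma chord3_not_X:
  assumes "\<not> X (y + 1)"
  shows "col y (y + 3) \<in> {edge (y + 1), edge (y + 2)} \<or> (col y (y + 3) = edge (y - 1) \<and> \<not> X (y - 1))"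
proof (rule ccontr)
  assume ne: "\<not> ?thesis"
  have Y: "c1 (y + 1 - t) = y + 1" "c2 (y + 1 - 2 * t) = y + 1"
    using assms c1_X[of "y + 1 - t"] c2_X[of "y + 1 - 2 * t"] X_period'[of "y + 1"] X_period'[of "y + 1 - t"]
    by auto
  have c: "col (y + 2) (y + 1 - t) = edge (y + 1)" "col (y + 2) (y + 1 - 2 * t) = edge (y + 1)"
      "col (y - t - 1) y = edge (c1 (y - t - 1))"
    using c1(3)[of "y + 1 - t"] c2(3)[of "y + 1 - 2 * t"] c1(3)[of "y - t - 1"] Y
      col_sym[of "y + 2" "y + 1 - t"] col_sym[of "y + 2" "y + 1 - 2 * t"] by (simp_all add: algebra_simps)
  have "\<exists>j\<in>{y + 1 - t..<y}. col y (y + 3) = edge j"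
  proof (rule ccontr)
    assume "\<not> ?thesis"
    then have "\<not> sp (t + 2)"
    proof (intro cycle2[OF c(1), of "y + 2" "y + 3" "y + 1 - t" y y "y + 3" "y + 1 - t" "y + 1 - t"])
      fix j assume "j = y + 1 \<or> y + 2 \<le> j \<and> j < y + 3 \<or> y + 1 - t \<le> j \<and> j < y"
      then have "j = y + 1 \<or> j = y + 2 \<or> j \<in> {y + 1 - t..<y}" by auto
      then show "col y (y + 3) \<noteq> edge j"
        using ne \<open>\<not> (\<exists>j\<in>_. _)\<close> by blast
    qed (use L3t t3 in \<open>simp_all add: seg_def\<close>)
    then show False using spt by simp
  qed
  then obtain j where j: "y + 1 - t \<le> j" "j < y" "col y (y + 3) = edge j" by auto
  have c3: "c1 (y - t - 1) = y - t - 1 \<or> (c1 (y - t - 1) = y - 1 \<and> \<not> X (y - 1))"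
    using c1_X[of "y - t - 1"] X_period'[of "y - 1"] by (auto simp: algebra_simps)
  have jne: "j \<noteq> c1 (y - t - 1)"
    using ne j c3 by auto
  have "\<not> sp (t + 2)"
    by (rule cycle3[OF c(2,3) j(3), where s = "y + 1 - 2 * t" and u = "y + 1 - 2 * t"
        and ?l1.0 = "y + 2" and ?h1.0 = "y + 3" and ?l2.0 = "y + 1 - 2 * t" and ?h2.0 = "y - t - 1"
        and ?l3.0 = y and ?h3.0 = y])
      (use j(1,2) jne c3 L3t t3 in \<open>auto simp: seg_def\<close>)
  then show False using spt by simp
qed

end

section \<open>Odd lengths\<close>

context block_cycle
begin

text \<open>If \<open>X\<close> failed at \<open>k + 1\<close>, the chord from \<open>k\<close> to
  \<open>k + 3\<close> would have the color of edge \<open>k + 1\<close> or \<open>k + 2\<close>.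
  With two long chords meeting where \<open>X\<close> changes it would close up to
  \<open>t + 2\<close> edges.\<close>

lemma no_mixed:
  assumes L: "L = 3 * t" and X: "X (k - 1)"
  shows "X (k + 1)"
proof (rule ccontr)
  assume Y: "\<not> X (k + 1)"
  obtain q where q: "q = k + 1 \<or> q = k + 2" "col k (k + 3) = edge q"
    using chord3_not_X[OF Y] X by auto
  \<comment> \<open>\<open>X\<close> holds at \<open>k - 1\<close> and, by periodicity, fails at
    \<open>k + 1 - t\<close>, so it changes in between.\<close>
  have "\<exists>i. 2 \<le> i \<and> i \<le> t - 1 \<and> X (k - i + 1) \<and> \<not> X (k - i)"
  proof (rule ccontr)
    assume *: "\<not> ?thesis"
    have "m \<le> t - 1 \<Longrightarrow> X (k - m)" if "1 \<le> m" for m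
      using that
    proof (induction m rule: int_ge_induct)
      case base
      then show ?case using X by simp
    next
      case (step m)
      have "k - (m + 1) + 1 = k - m" by simp
      then show ?case using step spec[OF *[simplified not_ex], of "m + 1"] by auto
    qed
    from this[of "t - 1"] have "X (k + 1 - t)" using t3 by (simp add: algebra_simps)
    then show False using Y X_period' by blast
  qed
  then obtain i where i: "2 \<le> i" "i \<le> t - 1" "X (k - i + 1)" "\<not> X (k - i)" by blast
  have "c2 (k - i) = k - i + 2 * t" using i(4) c2_X by simp
  then have c: "col (k - i) (k - i + 2 * t + 1) = edge (k - i + 2 * t)"
    using c2(3)[of "k - i"] by simp
  have "X (k - i + 2 * t + 1)"
    using i(3) X_period[of "k - i + 1"] X_period[of "k - i + 1 + t"] by (simp add: algebra_simps)
  then have "c2 (k - i + 2 * t + 1) = k - i + 2 * t + 1" using c2_X by simp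
  moreover have "k - i + 2 * t + 1 + 2 * t + 1 = k + t + 2 - i + L"
    using L by simp
  ultimately have c': "col (k - i + 2 * t + 1) (k + t + 2 - i) = edge (k - i + 2 * t + 1)"
    using c2(3)[of "k - i + 2 * t + 1"] by (simp only: col_shift)
  have "\<not> sp (t + 2)"
    by (rule cycle3[OF c c' q(2)[unfolded col_sym[of k]], where s = "k - i" and u = "k - i"
        and ?l1.0 = "k - i" and ?h1.0 = k and ?l2.0 = "k - i + 2 * t + 1" and ?h2.0 = "k - i + 2 * t + 1"
        and ?l3.0 = "k + 3" and ?h3.0 = "k + t + 2 - i"])
      (use i(1,2) q(1) L t3 in \<open>unfold seg_def, auto\<close>)
  then show False using spt by simp
qed

text \<open>With all chords directed, a chord of span 3 points either forward or backward; neighboring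
  chords of span 3 with opposite directions close up to a short cycle, so the direction is constant.\<close>

lemma not_all_X:
  assumes L: "L = 3 * t" and odd: "odd t" and X: "\<And>k. X k"
  shows False
proof (cases "\<exists>y. col y (y + 3) = edge (y + 3)")
  case False
  \<comment> \<open>Using \<open>t - 1\<close> disjoint chords shortens \<open>3 * t\<close> to
    \<open>t + 2\<close>.\<close>
  have "\<not> sp (L - 2 * (t - 1))"
  proof (rule shortcuts)
    fix i assume "0 \<le> i" "i < t - 1"
    show "\<exists>q. 0 + 3 * i \<le> q \<and> q < 0 + 3 * i + 3 \<and> col (0 + 3 * i) (0 + 3 * i + 3) = edge q"
      using chord3_X[of "0 + 3 * i"] X False
      by (auto intro: exI[of _ "0 + 3 * i"] exI[of _ "0 + 3 * i + 1"])
  qed (use L t3 in auto)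
  then show False using spt L by simp
next
  case True
  then obtain y0 where y0: "col y0 (y0 + 3) = edge (y0 + 3)" by blast
  have backward_Suc: "col (y + 1) (y + 4) = edge (y + 4)" if y: "col y (y + 3) = edge (y + 3)" for y
  proof (rule ccontr)
    assume ne: "\<not> ?thesis"
    obtain q where q: "q = y + 1 \<or> q = y + 2" "col (y + 1) (y + 4) = edge q"
      using chord3_X[of "y + 1"] X ne by (auto simp: add_ac)
    have "c2 (y + t + 2) = y + t + 2" using X c2_X by simp
    moreover have "y + t + 2 + 2 * t + 1 = y + 3 + L" using L by simp
    ultimately have c: "col (y + t + 2) (y + 3) = edge (y + t + 2)"
      using c2(3)[of "y + t + 2"] by (simp only: col_shift)
    have "\<not> sp (t + 2)"
      by (rule cycle3[OF y[unfolded col_sym[of y]] q(2) c, where s = y and u = y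
          and ?l1.0 = "y + 3" and ?h1.0 = "y + 3" and ?l2.0 = y and ?h2.0 = "y + 1"
          and ?l3.0 = "y + 4" and ?h3.0 = "y + t + 2"])
        (use q(1) L t3 in \<open>unfold seg_def, auto\<close>)
    then show False using spt by simp
  qed
  have backward: "col (x - 3) x = edge x" if "y0 + 3 \<le> x" for x
    using that
  proof (induction x rule: int_ge_induct)
    case base
    then show ?case using y0 by simp
  next
    case (step x)
    then show ?case using backward_Suc[of "x - 3"] by (simp add: algebra_simps)
  qed
  \<comment> \<open>A path zigzags down from \<open>p + t + 1\<close> by \<open>x\<close>,
    \<open>x - 3\<close>, \<open>x - 2\<close>, with the colors of edges \<open>x\<close> and
    \<open>x - 3\<close>. After \<open>r\<close> rounds it reaches \<open>p\<close> with
    \<open>t + 1\<close> edges. The color at the current endpoint stays free, at the end that of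
    edge \<open>p\<close>, which the closing chord has. The lowest chord used is the one from
    \<open>y0\<close>.\<close>
  define p where "p = y0 + 1"
  define r where "r = (t + 1) div 2"
  have r: "t = 2 * r - 1" using odd unfolding r_def by presburger
  have "m \<le> r \<Longrightarrow> \<exists>P Q. arc (p - 1) (p - 1) (p + t + 1) (p + t + 1 - 2 * m) (nat (2 * m)) P Q
      \<and> P \<subseteq> {p + t - 2 * m..p + t + 1} \<and> Q \<subseteq> {p + t - 2 * m..p + t + 1} - {p + t + 1 - 2 * m}" if "0 \<le> m" for m
    using that
  proof (induction m rule: int_ge_induct)
    case base
    show ?case using arc_single[of "p + t + 1" "p - 1" "p - 1"] L t3
      by (intro exI[of _ "{p + t + 1}"] exI[of _ "{}"]) auto
  next
    case (step m)
    define x where "x = p + t + 1 - 2 * m"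
    have "m \<le> r" "p + t - 2 * m = x - 1" using step by (auto simp: x_def)
    with step.IH obtain P Q where PQ: "arc (p - 1) (p - 1) (p + t + 1) x (nat (2 * m)) P Q"
        "P \<subseteq> {x - 1..p + t + 1}" "Q \<subseteq> {x - 1..p + t + 1} - {x}"
      unfolding x_def by metis
    have x: "p + 2 \<le> x" "x \<le> p + t + 1" using step r by (auto simp: x_def)
    have "arc (p - 1) (p - 1) (p + t + 1) (x - 2) (nat (2 * m) + nat (x - 2 - (x - 3)) + 1)
        (P \<union> {x - 3..x - 2}) (insert x (Q \<union> {x - 3..<x - 2}))"
    proof (rule arc_link[OF PQ(1) arc_up])
      show "col x (x - 3) = edge x"
        using backward[of x] x col_sym by (simp add: p_def)
      show "P \<inter> {x - 3..x - 2} = {}" "Q \<inter> {x - 3..<x - 2} = {}"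
        using PQ(2,3) by fastforce+
      show "x \<notin> Q \<union> {x - 3..<x - 2}" using PQ(3) by auto
    qed (use x L t3 in auto)
    moreover have "nat (2 * m) + nat (x - 2 - (x - 3)) + 1 = nat (2 * (m + 1))" "x - 2 = p + t + 1 - 2 * (m + 1)"
      using step by (auto simp: x_def)
    ultimately have "arc (p - 1) (p - 1) (p + t + 1) (p + t + 1 - 2 * (m + 1)) (nat (2 * (m + 1)))
        (P \<union> {x - 3..x - 2}) (insert x (Q \<union> {x - 3..<x - 2}))"
      by metis
    moreover have "P \<union> {x - 3..x - 2} \<subseteq> {p + t - 2 * (m + 1)..p + t + 1}"
      "insert x (Q \<union> {x - 3..<x - 2}) \<subseteq> {p + t - 2 * (m + 1)..p + t + 1} - {p + t + 1 - 2 * (m + 1)}"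
      using PQ(2,3) x by (auto simp: x_def)
    ultimately show ?case by blast
  qed
  from this[of r] obtain P Q where PQ: "arc (p - 1) (p - 1) (p + t + 1) (p + t + 1 - 2 * r) (nat (2 * r)) P Q"
      "Q \<subseteq> {p + t - 2 * r..p + t + 1} - {p + t + 1 - 2 * r}"
    using r t3 by auto
  have p: "p + t + 1 - 2 * r = p" "p + t - 2 * r = p - 1" using r by auto
  have "\<not> sp (t + 2)"
  proof (rule arc_close[OF PQ(1)[unfolded p]])
    have "c1 p = p" using X c1_X by simp
    then have "col p (p + t + 1) = edge p" using c1(3)[of p] by simp
    moreover have "{p - 1..p + t + 1} \<subseteq> {p - 1..<p - 1 + L}"
      using L t3 by auto
    then have "Q \<subseteq> {p - 1..<p - 1 + L}" "p \<notin> Q"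
      using PQ(2) unfolding p by auto
    then have "edge p \<notin> edge ` Q"
      using edge_mem[of Q "p - 1" p] L3 by simp
    ultimately show "col p (p + t + 1) \<notin> edge ` Q" by simp
  qed (use r t3 in auto)
  then show False using spt by simp
qed

text \<open>By \<open>no_mixed\<close>, \<open>X\<close> is invariant under steps of 2, which reach
  every index modulo the odd length. So \<open>X\<close> holds everywhere or nowhere, and reversing
  the cycle turns the second case into the first.\<close>

lemma odd_block_False:
  assumes L: "L = 3 * t" and odd: "odd t"
  shows False
proof -
  have two: "X (k + 2)" if "X k" for k
    using no_mixed[OF L, of "k + 1"] that by (simp add: add_ac)
  have "X (k + 2 * int m)" if "X k" for k m
  proof (induction m)
    case (Suc m)
    then show ?case using two[of "k + 2 * int m"] by (simp add: algebra_simps)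
  qed (use that in simp)
  note many = this
  obtain r where r: "t = 2 * r + 1" using odd by (rule oddE)
  have up: "X (k + 1)" if "X k" for k
  proof -
    have "k + 2 * int (nat (3 * r + 2)) = k + 1 + L" using r L t3 by simp
    then show ?thesis using many[OF that, of "nat (3 * r + 2)"] X_add_L by metis
  qed
  have down: "X (k - 1)" if "X k" for k
  proof -
    have "k + 2 * int (nat (3 * r + 1)) = k - 1 + L" using r L t3 by simp
    then show ?thesis using many[OF that, of "nat (3 * r + 1)"] X_add_L by metis
  qed
  show False
  proof (cases "\<exists>k. X k")
    case True
    then obtain k where k: "X k" by blast
    have "X i" for i
      by (induction i rule: int_induct[of _ k]) (use k up down in auto)
    then show False using not_all_X L odd by blast
  next
    case False
    interpret R: rainbow_cycle V \<gamma> L "\<lambda>i. v (- i)" by (rule reverse)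
    interpret R: block_cycle V \<gamma> L "\<lambda>i. v (- i)" t
      by unfold_locales (use t3 L2t spt tL L3t in \<open>auto simp: sp_def R.sp_def\<close>)
    have edge: "R.edge k = edge (- k - 1)" for k
      using col_sym[of "- k" "- k - 1"] by (simp add: R.edge_def edge_def R.col_def col_def)
    have "R.X k" for k
    proof -
      have "R.c1 k = k"
      proof (rule R.c1_eqI)
        have "c1 (- k - t - 1) = - k - 1"
          using c1_X[of "- k - t - 1"] False by simp
        then have "col (- k - t - 1) (- k) = edge (- k - 1)"
          using c1(3)[of "- k - t - 1"] by simp
        moreover have "- (k + t + 1) = - k - t - 1" by simp
        ultimately show "R.col k (k + t + 1) = R.edge k"
          using col_sym[of "- k - t - 1" "- k"] unfolding edge R.col_def col_def by metis
      qed (use t3 in auto)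
      then show ?thesis by (simp add: R.X_def)
    qed
    then show False using R.not_all_X L odd by blast
  qed
qed

end

section \<open>Length \<open>3 * t + 1\<close>\<close>

context gap_cycle
begin

text \<open>A sink is an edge \<open>K\<close> whose color all chords of span \<open>t + 1\<close>
  over it have. Such a chord or a long chord at \<open>K\<close> is combined with chords starting
  near the middle; as \<open>r\<close> is half of \<open>t + 1\<close>, the cycles formed have
  \<open>2 * r + 1 = t + 2\<close> edges.\<close>

lemma no_sink:
  assumes L: "L = 3 * t + 1" and odd: "odd t"
    and sink: "\<And>y. K - t \<le> y \<Longrightarrow> y \<le> K \<Longrightarrow> c1 y = K"
  shows False
proof -
  define r where "r = (t + 1) div 2"
  have r: "t = 2 * r - 1" using odd unfolding r_def by presburger
  have "c1 (K + 2 * t + 1) = K + L"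
    using sink[of "K - t"] c1_shift[of "K - t"] t3 L by (simp add: algebra_simps)
  moreover have "K + 2 * t + 1 + t + 1 = K + 3 * t + 2" "K + 3 * t + 2 = K + 1 + L" using L by simp_all
  ultimately have s1: "col (K + 2 * t + 1) (K + 3 * t + 2) = edge (K + L)" "col (K + 2 * t + 1) (K + 1) = edge (K + L)"
    using c1(3)[of "K + 2 * t + 1"] col_shift(2)[of "K + 2 * t + 1" "K + 1"] by metis+
  define D where "D = c2 (K + r)"
  have D: "K + r \<le> D" "D \<le> K + r + 2 * t" "col (K + r) (K + r + 2 * t + 1) = edge D"
    unfolding D_def by (rule c2)+
  \<comment> \<open>Otherwise the chord from \<open>K + r\<close> and the sink chord from
    \<open>K + 2 * t + 1\<close> close up to a rainbow cycle.\<close>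
  have D2: "K + 2 * t + 1 \<le> D"
  proof (rule ccontr)
    assume D_lt: "\<not> ?thesis"
    have "col (K + r + L) (K + r + 2 * t + 1) = edge (D + L)"
      using D(3) by (simp add: col_shift)
    then have d: "col (K + r + L) (K + 2 * t + 1 + r) = edge (D + L)" by (simp add: algebra_simps)
    have "\<not> sp (t + 2)"
      by (rule cycle2_edge[OF s1(1) d, where s = "K + 2 * t + 1" and u = "K + 2 * t + 1"
          and ?l1.0 = "K + 2 * t + 1" and ?h1.0 = "K + 2 * t + 1 + r"
          and ?l2.0 = "K + 3 * t + 2" and ?h2.0 = "K + r + L"])
        (use D(1,2) D_lt L t3 r in \<open>unfold seg_def, auto\<close>)
    then show False using spt by simp
  qed
  show False
  proof (cases "c2 K = K")
    case True
    define C where "C = c1 (K + t + r)"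
    have C: "K + t + r \<le> C" "C \<le> K + t + r + t" "col (K + t + r) (K + t + r + t + 1) = edge C"
      unfolding C_def by (rule c1)+
    have "C = D"
      unfolding C_def D_def by (rule c1_c2) (use D(1,2) D2 r t3 in \<open>unfold D_def, linarith+\<close>)
    have k: "col (K + L) (K + 2 * t + 1) = edge (K + L)"
      using c2(3)[of K] True by (simp add: col_shift)
    have "\<not> sp (t + 2)"
      by (rule cycle2_edge[OF C(3) k, where s = "K + 1" and u = "K + 1"
          and ?l1.0 = "K + t + r" and ?h1.0 = "K + 2 * t + 1" and ?l2.0 = "K + t + r + t + 1" and ?h2.0 = "K + L"])
        (use C(1,2) D2 \<open>C = D\<close> L t3 r in \<open>unfold seg_def, auto\<close>)
    then show False using spt by simp
  next
    case False
    have c2K: "K + t < c2 K"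
    proof (rule ccontr)
      assume "\<not> ?thesis"
      then have "c1 K = c2 K" using c1_c2[of K K] c2(1)[of K] t3 by simp
      then show False using sink[of K] False t3 by simp
    qed
    have k: "col (K + L) (K + 2 * t + 1) = edge (c2 K)"
      using c2(3)[of K] by (simp add: col_shift)
    have d: "col (K + r) (K + L - r + 1) = edge D"
    proof -
      have "K + r + 2 * t + 1 = K + L - r + 1" using L r by simp
      then show ?thesis using D(3) by metis
    qed
    have "\<not> sp (t + 2)"
      by (rule cycle3[OF k s1(2) d, where s = "K + 1" and u = "K + 1"
          and ?l1.0 = "K + L - r + 1" and ?h1.0 = "K + L" and ?l2.0 = "K + 2 * t + 1" and ?h2.0 = "K + 2 * t + 1"
          and ?l3.0 = "K + 1" and ?h3.0 = "K + r"])
        (use D(1,2) D2 c2K c2(2)[of K] L t3 r in \<open>unfold seg_def, auto\<close>)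
    then show False using spt by simp
  qed
qed

lemma c2_shift_nat: "c2 (i + int m * L) = c2 i + int m * L"
proof (induction m)
  case (Suc m)
  then show ?case using c2_shift[of "i + int m * L"] by (simp add: algebra_simps)
qed simp

text \<open>
  Call \<open>i\<close> early if \<open>c2 i < i + t\<close> and late if \<open>c2 i > i + t\<close>. Without sinks, \<open>i + t\<close> is late whenever
  \<open>i\<close> is early and whenever \<open>i\<close> is late, so an early \<open>i\<close> would come out late after \<open>L\<close> such steps.
\<close>

lemma c2_long:
  assumes L: "L = 3 * t + 1" and odd: "odd t"
  shows "c2 i > i + t"
proof -
  \<comment> \<open>All chords of span \<open>t + 1\<close> over edge \<open>i + t\<close> lie below
    the long chord from \<open>i\<close>, so \<open>c1_c2\<close> would make this edge a
    sink.\<close>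
  have ne: "c2 i \<noteq> i + t" for i
  proof
    assume c: "c2 i = i + t"
    have "c1 y = i + t" if "i + t - t \<le> y" "y \<le> i + t" for y
      using c1_c2[of i y] that c by simp
    then show False using no_sink[OF L odd] by blast
  qed
  have AB: "c2 (i + t) > i + 2 * t" if A: "c2 i < i + t" for i
  proof (rule ccontr)
    assume "\<not> ?thesis"
    then have w: "i + t \<le> c2 (i + t)" "c2 (i + t) < i + 2 * t"
      using ne[of "i + t"] c2(1)[of "i + t"] by auto
    \<comment> \<open>Since edge \<open>c2 i\<close> is not a sink, some short chord over it has
      another color; by \<open>c1_c2\<close> that chord starts before \<open>i\<close>.\<close>
    obtain y where y: "c2 i - t \<le> y" "y \<le> c2 i" "c1 y \<noteq> c2 i"
      using no_sink[OF L odd] by blast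
    have "y < i" using c1_c2[of i y] y A by force
    have "i + 2 * t + 1 = i - t + L" "i + t + 2 * t + 1 = i + L" using L by simp_all
    then have c: "col i (i - t) = edge (c2 i)" "col (i + t) i = edge (c2 (i + t))"
      using c2(3)[of i] c2(3)[of "i + t"] by (simp_all only: col_shift)
    have "\<not> sp (t + 2)"
      by (rule cycle3[OF c(1) c1(3)[of y] c(2), where s = "i - t" and u = "i - t"
          and ?l1.0 = i and ?h1.0 = i and ?l2.0 = "i - t" and ?h2.0 = y and ?l3.0 = "y + t + 1" and ?h3.0 = "i + t"])
        (use y \<open>y < i\<close> w A c2(1)[of i] c1(1,2)[of y] L t3 in \<open>unfold seg_def, auto\<close>)
    then show False using spt by simp
  qed
  have B: "c2 (j + t) > j + 2 * t" if B: "c2 j > j + t" for j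
  proof (rule ccontr)
    assume "\<not> ?thesis"
    then have w: "c2 (j + t) < j + 2 * t" using ne[of "j + t"] by auto
    have "c1 (j + t) = c2 (j + t)" "c1 (j + t) = c2 j"
      using c1_c2[of "j + t" "j + t"] c1_c2[of j "j + t"] w B c2[of j] c2[of "j + t"] t3 by auto
    then have e: "c2 (j + t) = c2 j" by simp
    \<comment> \<open>The long chords from \<open>j\<close> and \<open>j + t\<close> share a color
      and together cover all short chords over its edge.\<close>
    have "c1 y = c2 j" if "c2 j - t \<le> y" "y \<le> c2 j" for y
      using c1_c2[of j y] c1_c2[of "j + t" y] that B w e by (cases "y \<le> j + t") auto
    then show False using no_sink[OF L odd] by blast
  qed
  show ?thesis
  proof (rule ccontr)
    assume "\<not> ?thesis"
    then have A: "c2 i < i + t" using ne[of i] by auto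
    have "c2 (i + int (Suc m) * t) > i + int (Suc m) * t + t" for m
    proof (induction m)
      case 0
      then show ?case using AB[OF A] by simp
    next
      case (Suc m)
      then show ?case using B[of "i + int (Suc m) * t"] by (simp add: algebra_simps)
    qed
    \<comment> \<open>After \<open>L\<close> steps of \<open>t\<close> the index has moved by a
      multiple of \<open>L\<close>, so \<open>c2\<close> there is a shift of the early value
      \<open>c2 i\<close>.\<close>
    from this[of "nat (L - 1)"] have "c2 (i + L * t) > i + L * t + t"
      using L3 by simp
    then show False
      using A c2_shift_nat[of i "nat t"] t3 by (simp add: mult.commute)
  qed
qed

text \<open>By \<open>c2_long\<close> the color of a long chord lies past its middle edge; for the
  reversed cycle this puts it before the middle edge.\<close>

lemma odd_succ_False:
  assumes L: "L = 3 * t + 1" and odd: "odd t"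
  shows False
proof -
  interpret R: rainbow_cycle V \<gamma> L "\<lambda>i. v (- i)" by (rule reverse)
  interpret R: gap_cycle V \<gamma> L "\<lambda>i. v (- i)" t
    by unfold_locales (use t3 L2t spt in \<open>auto simp: sp_def R.sp_def\<close>)
  define q where "q = c2 (- 2 * t - 1)"
  have q: "- 2 * t - 1 \<le> q" "q \<le> - 1" "col (- 2 * t - 1) 0 = edge q"
    using c2[of "- 2 * t - 1"] by (simp_all add: q_def)
  have "R.edge (- q - 1) = edge q"
    using col_sym[of "q + 1" q] by (simp add: R.edge_def edge_def R.col_def col_def add.commute)
  moreover have "R.col 0 (2 * t + 1) = col (- 2 * t - 1) 0"
    using col_sym[of "- 2 * t - 1" 0] by (simp add: R.col_def col_def)
  ultimately have "R.c2 0 = - q - 1"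
    using q by (intro R.c2_eqI) auto
  then show False
    using R.c2_long[OF L odd, of 0] c2_long[OF L odd, of "- 2 * t - 1"] by (simp add: q_def)
qed

end

section \<open>Even lengths\<close>

context gap_cycle
begin

text \<open>The chord from \<open>0\<close> to \<open>H - 1\<close> closes a rainbow cycle
  \<open>C\<close> whose length \<open>t\<close> divides. A chord of span 3 with an outer color
  would close up to \<open>t + 2\<close> edges with two chords of \<open>C\<close> and one chord
  around the rest of the long cycle. The bounds on \<open>y\<close> keep the chords of span
  \<open>t + 1\<close> from \<open>y\<close> and into \<open>y + 3\<close> within
  \<open>C\<close>.\<close>

lemma short_chord3:
  assumes L: "L = 2 * H - 2" and H: "t dvd H" "3 * t \<le> H" and t4: "4 \<le> t"
    and new: "col (H - 1) 0 \<notin> edge ` {0..<H - 1}"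
    and y: "t - 2 \<le> y" "y \<le> H - t - 2"
  shows "\<exists>q. y \<le> q \<and> q < y + 3 \<and> col y (y + 3) = edge q"
proof (rule ccontr)
  assume ne: "\<not> ?thesis"
  interpret C: rainbow_cycle V \<gamma> H "\<lambda>i. v (i mod H)"
    by (rule subcycle) (use L H t4 new in auto)
  interpret C: block_cycle V \<gamma> H "\<lambda>i. v (i mod H)" t
    by unfold_locales (use t3 spt H t4 in \<open>auto simp: sp_def C.sp_def\<close>)
  have col: "C.col i j = col i j" if "0 \<le> i" "i < H" "0 \<le> j" "j < H" for i j
    using that by (simp add: C.col_def col_def)
  have edge: "C.edge i = edge i" if "0 \<le> i" "i < H - 1" for i
    using that col[of i "i + 1"] by (simp add: C.edge_def edge_def)
  obtain q4 where q4: "q4 = y + 3 \<or> q4 = y - 1" "col y (y + 3) = edge q4"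
  proof (cases "C.X (y + 1)")
    case True
    have "col y (y + 3) = edge (y + 3)"
      using C.chord3_X[OF True] ne col[of y "y + 3"] edge[of y] edge[of "y + 1"] edge[of "y + 3"] y t4 by auto
    then show thesis using that by blast
  next
    case False
    have "col y (y + 3) = edge (y - 1)"
      using C.chord3_not_X[OF False] ne col[of y "y + 3"] edge[of "y + 1"] edge[of "y + 2"] edge[of "y - 1"] y t4 by auto
    then show thesis using that by blast
  qed
  obtain q1 where q1: "q1 = y \<or> q1 = y + t" "col y (y + t + 1) = edge q1"
    using C.c1(3)[of y] C.c1_X[of y] col[of y "y + t + 1"] edge[of y] edge[of "y + t"] y t4 by (auto split: if_splits)
  have s: "y + 2 - t + t + 1 = y + 3" by simp
  have "C.c1 (y + 2 - t) = (if C.X (y + 2 - t) then y + 2 - t else y + 2)"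
    using C.c1_X[of "y + 2 - t"] by simp
  with C.c1(3)[of "y + 2 - t", unfolded s]
  have k1: "C.col (y + 2 - t) (y + 3) = C.edge (if C.X (y + 2 - t) then y + 2 - t else y + 2)"
    by (rule subst[rotated])
  have k2: "C.col (y + 2 - t) (y + 3) = col (y + 2 - t + L) (y + 3)"
    unfolding col_shift using y t4 by (intro col) auto
  have k3: "C.edge (y + 2 - t) = edge (y + 2 - t + L)" "C.edge (y + 2) = edge (y + 2)"
    unfolding edge_shift using y t4 by (auto intro!: edge)
  obtain q3 where q3: "q3 = y + 2 - t + L \<or> q3 = y + 2" "col (y + 2 - t + L) (y + 3) = edge q3"
  proof (cases "C.X (y + 2 - t)")
    case True
    then show thesis using that k1 k2 k3(1) by (simp only: if_True) blast
  next
    case False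
    then show thesis using that k1 k2 k3(2) by (simp only: if_False) blast
  qed
  have "sp (2 * H - 3 * t + 2)" using H t4 by (intro sp_multiple) auto
  then have "\<exists>q2. y + 2 * t - 1 \<le> q2 \<and> q2 < y + 2 - t + L \<and> col (y + 2 * t - 1) (y + 2 - t + L) = edge q2"
    by (rule chord_color) (use L H(2) t4 in linarith)+
  then obtain q2 where q2: "y + 2 * t - 1 \<le> q2" "q2 < y + 2 - t + L" "col (y + 2 * t - 1) (y + 2 - t + L) = edge q2"
    by blast
  \<comment> \<open>Index \<open>y - 1\<close> is moved up by one period into the window starting at
    \<open>y\<close>.\<close>
  define q4' where "q4' = (if q4 = y + 3 then q4 else q4 + L)"
  have q4': "q4' = y + 3 \<or> q4' = y - 1 + L" "col (y + 3) y = edge q4'"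
    using q4 col_sym[of y "y + 3"] by (auto simp: q4'_def)
  have "\<not> sp (t + 2)"
    by (rule cycle4[OF q1(2) q2(3) q3(2) q4'(2), where s = y and u = y
        and ?l1.0 = y and ?h1.0 = y and ?l2.0 = "y + t + 1" and ?h2.0 = "y + 2 * t - 1"
        and ?l3.0 = "y + 2 - t + L" and ?h3.0 = "y + 2 - t + L" and ?l4.0 = "y + 3" and ?h4.0 = "y + 3"])
      (use q1(1) q2(1,2) q3(1) q4'(1) L H(2) t4 in \<open>unfold seg_def, auto\<close>)
  then show False using spt by simp
qed

lemma even_half_False:
  assumes L: "L = 2 * H - 2" and H: "t dvd H" "3 * t \<le> H" and t: "4 \<le> t" "even t"
    and room: "3 * (t div 2 - 3) \<le> H - 2 * t"
    and new: "col (H - 1) 0 \<notin> edge ` {0..<H - 1}"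
  shows False
proof -
  \<comment> \<open>This many shortcuts reduce the length to \<open>2 * H - t + 2\<close>, which is
    excluded because \<open>t\<close> divides \<open>2 * H - t\<close>. By \<open>room\<close>, the
    last chord still starts in the range of \<open>short_chord3\<close>.\<close>
  define m where "m = t div 2 - 2"
  have m: "t = 2 * m + 4" using t unfolding m_def by presburger
  have "\<not> sp (L - 2 * m)"
  proof (rule shortcuts)
    fix i assume i: "0 \<le> i" "i < m"
    have "t - 2 + 3 * i \<le> H - t - 2"
      using i room by (simp add: m_def)
    then show "\<exists>q. t - 2 + 3 * i \<le> q \<and> q < t - 2 + 3 * i + 3 \<and> col (t - 2 + 3 * i) (t - 2 + 3 * i + 3) = edge q"
      using i by (intro short_chord3[OF L H t(1) new]) auto
  qed (use L H(2) m t in auto)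
  moreover have "L - 2 * m = 2 * H - t + 2" using L m by simp
  moreover have "sp (2 * H - t + 2)" using H t by (intro sp_multiple) auto
  ultimately show False by simp
qed

text \<open>The color of the diameter cannot occur on both halves. A rotation by
  \<open>H - 1\<close> brings a half without it to the front.\<close>

lemma even_False:
  assumes L: "L = 2 * H - 2" and H: "t dvd H" "3 * t \<le> H" and t: "4 \<le> t" "even t"
    and room: "3 * (t div 2 - 3) \<le> H - 2 * t"
  shows False
proof (cases "col (H - 1) 0 \<in> edge ` {0..<H - 1}")
  case False
  then show False using even_half_False[OF assms] by blast
next
  case True
  interpret R: rainbow_cycle V \<gamma> L "\<lambda>i. v (i + (H - 1))" by (rule rotate)
  interpret R: gap_cycle V \<gamma> L "\<lambda>i. v (i + (H - 1))" t
    by unfold_locales (use t3 L2t spt in \<open>auto simp: sp_def R.sp_def\<close>)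
  have "H - 1 + (H - 1) = 0 + L" using L by simp
  then have "R.col (H - 1) 0 = col 0 (H - 1)"
    by (metis R.col_def add_0 col_def col_shift(1))
  moreover have "R.edge i = edge (i + (H - 1))" for i
  proof -
    have "i + 1 + (H - 1) = i + (H - 1) + 1" by simp
    then show ?thesis unfolding R.edge_def R.col_def edge_def col_def by metis
  qed
  moreover have "edge q \<noteq> edge (i + (H - 1))" if "0 \<le> q" "q < H - 1" "0 \<le> i" "i < H - 1" for q i
    using edge_window[of 0 q "i + (H - 1)"] that L by auto
  moreover obtain q where "0 \<le> q" "q < H - 1" "col 0 (H - 1) = edge q"
    using True col_sym[of "H - 1" 0] by auto
  ultimately have "R.col (H - 1) 0 \<noteq> R.edge i" if "0 \<le> i" "i < H - 1" for i
    using that by metis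
  then have "R.col (H - 1) 0 \<notin> R.edge ` {0..<H - 1}"
    by force
  then show False using R.even_half_False[OF assms] by blast
qed

end

section \<open>Excluded lengths and the monoid they generate\<close>

lemma gap_cycle_of_not_spec:
  assumes n: "t + 2 \<in> spec V (nsets V 2) \<gamma>" and "m \<notin> spec V (nsets V 2) \<gamma>"
    and t: "t \<ge> 3" "m \<ge> 2 * t + 2"
  shows "\<exists>v. gap_cycle V \<gamma> (int m) v (int t)"
proof -
  obtain v where "rainbow_cycle V \<gamma> (int m) v"
    using not_spec_rainbow_cycle[of m V \<gamma>] assms by force
  then interpret rainbow_cycle V \<gamma> "int m" v .
  have "nat (int t + 2) = t + 2" by simp
  then have "gap_cycle V \<gamma> (int m) v (int t)"
    by unfold_locales (use n t in \<open>auto simp: sp_def\<close>)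
  then show ?thesis by blast
qed

lemma spec_odd_block:
  assumes n: "t + 2 \<in> spec V (nsets V 2) \<gamma>" and t: "t \<ge> 3" "odd t"
  shows "3 * t \<in> spec V (nsets V 2) \<gamma>"
proof (rule ccontr)
  assume ns: "\<not> ?thesis"
  have "2 * t + 2 \<le> 3 * t" using t by simp
  then obtain v where "gap_cycle V \<gamma> (int (3 * t)) v (int t)"
    using gap_cycle_of_not_spec[OF n ns t(1)] by blast
  then interpret gap_cycle V \<gamma> "int (3 * t)" v "int t" .
  interpret block_cycle V \<gamma> "int (3 * t)" v "int t"
    by unfold_locales auto
  show False using odd_block_False t by simp
qed

lemma spec_odd_succ:
  assumes n: "t + 2 \<in> spec V (nsets V 2) \<gamma>" and t: "t \<ge> 3" "odd t"
  shows "3 * t + 1 \<in> spec V (nsets V 2) \<gamma>"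
proof (rule ccontr)
  assume ns: "\<not> ?thesis"
  have "2 * t + 2 \<le> 3 * t + 1" using t by simp
  then obtain v where "gap_cycle V \<gamma> (int (3 * t + 1)) v (int t)"
    using gap_cycle_of_not_spec[OF n ns t(1)] by blast
  then interpret gap_cycle V \<gamma> "int (3 * t + 1)" v "int t" .
  show False using odd_succ_False t by simp
qed

text \<open>For \<open>H = b * t\<close> the condition \<open>room\<close> always holds if
  \<open>b \<ge> 4\<close>, whereas \<open>b = 3\<close> requires \<open>t \<le> 18\<close>.\<close>

lemma spec_even:
  assumes n: "t + 2 \<in> spec V (nsets V 2) \<gamma>" and t: "t \<ge> 4" "even t"
    and b: "b \<ge> 4 \<or> b = 3 \<and> t \<le> 18"
  shows "2 * b * t - 2 \<in> spec V (nsets V 2) \<gamma>"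
proof (rule ccontr)
  assume ns: "\<not> ?thesis"
  have bt: "b * t \<ge> 4 * t \<or> b * t = 3 * t \<and> t \<le> 18"
    using b by auto
  have t3: "t \<ge> 3" using t by simp
  have "2 * t + 2 \<le> 2 * b * t - 2"
    using bt t by linarith
  then obtain v where "gap_cycle V \<gamma> (int (2 * b * t - 2)) v (int t)"
    using gap_cycle_of_not_spec[OF n ns t3] by blast
  then interpret gap_cycle V \<gamma> "int (2 * b * t - 2)" v "int t" .
  have H: "int (b * t) \<ge> 4 * int t \<or> int (b * t) = 3 * int t \<and> int t \<le> 18"
    using bt by linarith
  show False
  proof (rule even_False)
    show "int (2 * b * t - 2) = 2 * int (b * t) - 2"
      using bt t by linarith
    show "3 * (int t div 2 - 3) \<le> int (b * t) - 2 * int t"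
    proof -
      have "3 * (d - 3) \<le> B - 2 * s"
        if "2 * d \<le> s" "4 * s \<le> B \<or> B = 3 * s \<and> s \<le> 18" "0 \<le> s" for d B s :: int
        using that(2) that(1,3) by (elim disjE conjE) (simp_all add: algebra_simps)
      moreover have "2 * (int t div 2) \<le> int t" by simp
      ultimately show ?thesis using H by simp
    qed
  qed (use H t in auto)
qed

section \<open>Combinations of two or three generators\<close>

lemma spec_combination:
  assumes "t + 2 \<in> spec V (nsets V 2) \<gamma>" "s + 2 \<in> spec V (nsets V 2) \<gamma>"
  shows "a * t + b * s + 2 \<in> spec V (nsets V 2) \<gamma>"
proof -
  have "(a * t + 2) + (b * s + 2) - 2 = a * t + b * s + 2" by simp
  then show ?thesis
    using spec_add[OF spec_multiple[OF assms(1), of a] spec_multiple[OF assms(2), of b]] by metis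
qed

text \<open>The coefficient \<open>c < u\<close> of \<open>g\<close> is determined by
  \<open>k\<close> modulo \<open>u\<close>. If \<open>g * c\<close> exceeded \<open>k\<close>, it
  would do so by a positive multiple of \<open>u\<close>, but the bound on \<open>k\<close> leaves
  at most \<open>u - 1\<close>.\<close>

lemma nonneg_combination:
  fixes u g k :: nat
  assumes co: "coprime u g" and pos: "u \<ge> 1" "g \<ge> 1" and k: "k \<ge> (u - 1) * (g - 1)"
  shows "\<exists>a b. k = a * u + b * g"
proof -
  obtain x where x: "[g * x = 1] (mod u)"
    using cong_solve_coprime_nat[of g u] co by (auto simp: coprime_commute)
  define c where "c = (x * k) mod u"
  have "[g * c = g * x * k] (mod u)"
    unfolding c_def by (simp add: cong_def mod_mult_right_eq mult.assoc)
  also have "[g * x * k = 1 * k] (mod u)"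
    by (rule cong_scalar_right[OF x])
  finally have c: "[g * c = k] (mod u)" by simp
  have "c \<le> u - 1" using pos by (simp add: c_def less_Suc_eq_le[symmetric])
  then have gc: "g * c \<le> g * (u - 1)" by simp
  have "g * c \<le> k"
  proof (rule ccontr)
    assume "\<not> ?thesis"
    then have "u dvd g * c - k" "g * c - k > 0"
      using c cong_altdef_nat[of k "g * c" u] by auto
    then have "u \<le> g * c - k" by (rule dvd_imp_le)
    moreover have "g * (u - 1) = (u - 1) * (g - 1) + (u - 1)"
      using pos by (cases u; cases g) auto
    ultimately show False using gc k pos by linarith
  qed
  then have "u dvd k - g * c"
    using cong_sym[OF c] cong_altdef_nat[of "g * c" k u] by auto
  then obtain a where "k - g * c = u * a" by blast
  then have "k = a * u + c * g" using \<open>g * c \<le> k\<close> by (simp add: algebra_simps)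
  then show ?thesis by blast
qed

text \<open>For \<open>t = 2 * w + 1\<close> the generators are \<open>t\<close>,
  \<open>3 * t - 2\<close> and \<open>3 * t - 1\<close>, congruent to 0, -2 and -1 modulo
  \<open>t\<close>. As \<open>j\<close> is the residue of \<open>- m\<close>, writing
  \<open>j = 2 * i + c\<close> needs at most \<open>w\<close> generators of the last two kinds. The
  threshold is the bound for odd \<open>n = 2 * w + 3\<close>, less 2.\<close>

lemma odd_combination:
  fixes w m :: nat
  assumes w: "w \<ge> 1" and m: "m \<ge> 2 * w * (4 * w - 1)"
  shows "\<exists>a b c. m = a * (2 * w + 1) + b * (6 * w + 1) + c * (6 * w + 2)"
proof -
  define j where "j = (2 * w * m) mod (2 * w + 1)"
  have j: "j \<le> 2 * w" by (simp add: j_def less_Suc_eq_le[symmetric])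
  have dvd: "int (2 * w + 1) dvd int m + int j"
  proof -
    have "int j mod int (2 * w + 1) = (2 * int w * int m) mod int (2 * w + 1)"
      unfolding j_def by (simp add: zmod_int)
    then have "(int m + int j) mod int (2 * w + 1) = (int m + 2 * int w * int m) mod int (2 * w + 1)"
      by (metis mod_add_right_eq)
    also have "int m + 2 * int w * int m = int m * int (2 * w + 1)"
      by (simp add: algebra_simps)
    finally show ?thesis by (simp add: mod_eq_0_iff_dvd)
  qed
  define i where "i = j div 2"
  define c where "c = j mod 2"
  have ji: "j = 2 * i + c" "c \<le> 1" by (simp_all add: i_def c_def)
  define R where "R = i * (6 * w + 1) + c * (6 * w + 2)"
  have "int m + int j - (int m - int R) = int (2 * w + 1) * int (3 * i + 3 * c)"
    unfolding R_def ji(1) by (simp add: algebra_simps)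
  then have "int m - int R = int m + int j - int (2 * w + 1) * int (3 * i + 3 * c)"
    by linarith
  then have d: "int (2 * w + 1) dvd int m - int R"
    using dvd_diff[OF dvd dvd_triv_left[of "int (2 * w + 1)" "int (3 * i + 3 * c)"]] by metis
  have "int R \<le> int m + 2 * int w"
  \<comment> \<open>This slack suffices: \<open>m - R\<close> is a multiple of
    \<open>2 * w + 1\<close> and at least \<open>- 2 * w\<close>, hence nonnegative.\<close>
  proof -
    have "int m \<ge> 2 * int w * (4 * int w - 1)"
    proof -
      have "int (4 * w - 1) = 4 * int w - 1" using w by simp
      then have "int (2 * w * (4 * w - 1)) = 2 * int w * (4 * int w - 1)" by simp
      then show ?thesis using m by linarith
    qed
    then have m2: "8 * (int w * int w) - 2 * int w \<le> int m" by (simp add: algebra_simps)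
    have w2: "int w \<le> int w * int w" using w by (cases w) auto
    have ww: "int w * (6 * int w + 1) = 6 * (int w * int w) + int w" by (simp add: algebra_simps)
    show ?thesis
    proof (cases "c = 0")
      case True
      then have "i \<le> w" using j ji by simp
      then have "int i * (6 * int w + 1) \<le> int w * (6 * int w + 1)"
        by (intro mult_right_mono) auto
      moreover have "int R = int i * (6 * int w + 1)"
        by (simp add: R_def True algebra_simps)
      ultimately have "int R \<le> int w * (6 * int w + 1)" by linarith
      then show ?thesis using m2 w2 unfolding ww by linarith
    next
      case False
      then have "c = 1" "i + 1 \<le> w" using j ji by auto
      then have "int (i + 1) * (6 * int w + 1) \<le> int w * (6 * int w + 1)"
        by (intro mult_right_mono) auto
      then have "int R \<le> int w * (6 * int w + 1) + 1"
        unfolding R_def \<open>c = 1\<close> by (simp add: algebra_simps)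
      then show ?thesis using m2 w2 w unfolding ww by linarith
    qed
  qed
  obtain a where a: "int m - int R = int (2 * w + 1) * a" using d by blast
  have "a \<ge> 0"
  proof (rule ccontr)
    assume "\<not> ?thesis"
    then have "int (2 * w + 1) * a \<le> int (2 * w + 1) * (- 1)" by (intro mult_left_mono) auto
    then show False using a \<open>int R \<le> int m + 2 * int w\<close> by simp
  qed
  then have "int m = int (nat a * (2 * w + 1) + i * (6 * w + 1) + c * (6 * w + 2))"
    using a unfolding R_def by (simp add: algebra_simps)
  then show ?thesis by (metis of_nat_eq_iff)
qed

theorem theorem5p1:
  fixes V :: "'a set" and E :: "'a set set" and \<gamma> :: "'a set \<Rightarrow> 'c" and n :: nat
  assumes "infinite V"
    and "complete_graph V E"
    and "n \<in> spec V E \<gamma>"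
  shows "(n \<ge> 3 \<and> odd n \<longrightarrow>
            (\<exists>N::nat. real N \<le> 2 * (real n)^2 - 13 * real n + 23 \<and>
               {N + j | j::nat. j \<ge> 0} \<subseteq> spec V E \<gamma>)) \<and>
         (n mod 4 = 2 \<and> n \<ge> 6 \<longrightarrow>
            (\<exists>N::nat. real N \<le> 9 / 4 * (real n)^2 - 18 * real n + 37 \<and>
               {N + 4 * j | j::nat. j \<ge> 0} \<subseteq> spec V E \<gamma>)) \<and>
         (n > 0 \<and> 4 dvd n \<longrightarrow>
            (\<exists>N::nat. real N \<le> 9 / 2 * (real n)^2 - 39 * real n + 86 \<and>
               {N + 2 * j | j::nat. j \<ge> 0} \<subseteq> spec V E \<gamma>))"
proof (intro conjI impI)
  have E: "E = nsets V 2" using assms(2) by (simp add: complete_graph_def)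
  have n: "n \<in> spec V (nsets V 2) \<gamma>" using assms(3) E by simp
  have scale: "m * k + m * j = a * (m * u) + b * (m * g)" if "k + j = a * u + b * g" for m k j a u b g :: nat
    using arg_cong[OF that, of "\<lambda>z. m * z"] by (simp add: algebra_simps)
  {
    assume a: "n \<ge> 3 \<and> odd n"
    define w where "w = (n - 3) div 2"
    have w: "n = 2 * w + 1 + 2" using a unfolding w_def by presburger
    have "2 * w * (4 * w - 1) + 2 + j \<in> spec V E \<gamma>" for j
    \<comment> \<open>For \<open>n = 3\<close> the shift \<open>t = 1\<close> is too small for
      \<open>gap_cycle\<close>, but its multiples are all numbers.\<close>
    proof (cases "w = 0")
      case True
      then show ?thesis
        using spec_multiple[of 1 V \<gamma> j] n w E by (simp add: add.commute)
    next
      case False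
      then have w1: "w \<ge> 1" by simp
      obtain a b c where abc: "2 * w * (4 * w - 1) + j = a * (2 * w + 1) + b * (6 * w + 1) + c * (6 * w + 2)"
        using odd_combination[OF w1, of "2 * w * (4 * w - 1) + j"] by auto
      have "6 * w + 1 + 2 \<in> spec V (nsets V 2) \<gamma>" "6 * w + 2 + 2 \<in> spec V (nsets V 2) \<gamma>"
      proof -
        have "2 * w + 1 + 2 \<in> spec V (nsets V 2) \<gamma>" "2 * w + 1 \<ge> 3" "odd (2 * w + 1)"
          using n w w1 by auto
        moreover have "6 * w + 1 + 2 = 3 * (2 * w + 1)" "6 * w + 2 + 2 = 3 * (2 * w + 1) + 1"
          by simp_all
        ultimately show "6 * w + 1 + 2 \<in> spec V (nsets V 2) \<gamma>" "6 * w + 2 + 2 \<in> spec V (nsets V 2) \<gamma>"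
          using spec_odd_block spec_odd_succ by metis+
      qed
      then have "1 * (a * (2 * w + 1) + b * (6 * w + 1)) + c * (6 * w + 2) + 2 \<in> spec V (nsets V 2) \<gamma>"
        using n w by (intro spec_combination) auto
      then show ?thesis using abc E by (simp add: add_ac)
    qed
    moreover have "real (2 * w * (4 * w - 1) + 2) \<le> 2 * (real n)^2 - 13 * real n + 23"
      by (cases w) (simp_all add: w power2_eq_square algebra_simps)
    ultimately show "\<exists>N::nat. real N \<le> 2 * (real n)^2 - 13 * real n + 23 \<and>
        {N + j | j::nat. j \<ge> 0} \<subseteq> spec V E \<gamma>"
      by blast
  }
  {
    assume a: "n mod 4 = 2 \<and> n \<ge> 6"
    define u where "u = n div 4"
    have u: "n = 4 * u + 2" "u \<ge> 1" using a unfolding u_def by presburger+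
    \<comment> \<open>Here \<open>t = 4 * u\<close>. Dividing \<open>t\<close> and
      \<open>8 * t - 4\<close> by 4 leaves the coprime numbers \<open>u\<close> and
      \<open>8 * u - 1\<close>.\<close>
    have "2 * 4 * (4 * u) - 2 \<in> spec V (nsets V 2) \<gamma>"
      by (rule spec_even) (use n u in auto)
    moreover have "2 * 4 * (4 * u) - 2 = 4 * (8 * u - 1) + 2"
      using u by simp
    ultimately have s: "4 * (8 * u - 1) + 2 \<in> spec V (nsets V 2) \<gamma>"
      by metis
    have "4 * ((u - 1) * (8 * u - 2)) + 2 + 4 * j \<in> spec V E \<gamma>" for j
    proof -
      have "coprime u (8 * u - 1)"
      proof (rule coprimeI)
        fix d assume "d dvd u" "d dvd 8 * u - 1"
        then have "d dvd 8 * u - (8 * u - 1)" by (metis dvd_diff_nat dvd_mult)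
        moreover have "8 * u - (8 * u - 1) = 1" using u by simp
        ultimately show "is_unit d" by metis
      qed
      moreover have "1 \<le> 8 * u - 1" "8 * u - 1 - 1 = 8 * u - 2" using u by simp_all
      then have "1 \<le> 8 * u - 1" "(u - 1) * (8 * u - 1 - 1) \<le> (u - 1) * (8 * u - 2) + j"
        by (metis le_add1)+
      ultimately obtain a b where ab: "(u - 1) * (8 * u - 2) + j = a * u + b * (8 * u - 1)"
        using nonneg_combination[OF _ u(2)] by blast
      have "4 * ((u - 1) * (8 * u - 2)) + 2 + 4 * j = a * (4 * u) + b * (4 * (8 * u - 1)) + 2"
        using scale[OF ab, of 4] by linarith
      then show ?thesis
        using spec_combination[OF _ s, of "4 * u" a b] n unfolding u(1) E by metis
    qed
    moreover have "real (4 * ((u - 1) * (8 * u - 2)) + 2) \<le> 9 / 4 * (real n)^2 - 18 * real n + 37"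
    proof -
      obtain x where "u = Suc x" using u by (cases u) auto
      then show ?thesis by (simp add: u(1) power2_eq_square algebra_simps)
    qed
    ultimately show "\<exists>N::nat. real N \<le> 9 / 4 * (real n)^2 - 18 * real n + 37 \<and>
        {N + 4 * j | j::nat. j \<ge> 0} \<subseteq> spec V E \<gamma>"
      by blast
  }
  {
    assume a: "n > 0 \<and> 4 dvd n"
    define x where "x = n div 4 - 1"
    have x: "n = 4 * x + 4" using a unfolding x_def by presburger
    define h where "h = 2 * x + 1"
    have h: "n = 2 * h + 2" using x by (simp add: h_def)
    \<comment> \<open>\<open>x \<le> 4\<close> means \<open>t = 4 * x + 2 \<le> 18\<close>, which
      permits \<open>b = 3\<close>. With \<open>b = 4\<close> the threshold would exceed the bound
      for \<open>x\<close> from 1 to 3.\<close>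
    define b where "b = (if x \<le> 4 then 3 else 4 :: nat)"
    define g where "g = 2 * b * h - 2"
    have b: "b = 3 \<and> x \<le> 4 \<or> b = 4 \<and> x \<ge> 5" by (auto simp: b_def)
    have g: "g \<ge> 1" "g + 2 = 2 * b * h" using b by (auto simp: g_def h_def)
    have s: "2 * g + 2 \<in> spec V (nsets V 2) \<gamma>" if "x \<ge> 1"
    proof -
      have "2 * b * (2 * h) - 2 \<in> spec V (nsets V 2) \<gamma>"
        using n that b by (intro spec_even) (auto simp: h h_def)
      moreover have "2 * b * (2 * h) - 2 = 2 * g + 2" using g by (simp add: g_def)
      ultimately show ?thesis by metis
    qed
    have "2 * ((h - 1) * (g - 1)) + 2 + 2 * j \<in> spec V E \<gamma>" for j
    proof (cases "x = 0")
      case True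
      then show ?thesis using spec_multiple[of 2 V \<gamma> j] n x E by (simp add: h_def add.commute mult.commute)
    next
      case False
      \<comment> \<open>A common divisor divides \<open>2 * b * h - g = 2\<close>, and
        \<open>h\<close> is odd.\<close>
      have "coprime h g"
      proof (rule coprimeI)
        fix d assume d: "d dvd h" "d dvd g"
        then have "d dvd g + 2 - g" unfolding g(2) by (metis dvd_diff_nat dvd_mult)
        then have "d dvd 2" by simp
        then have "d \<le> 2" "d \<noteq> 0" using dvd_imp_le[of d 2] by (simp, cases d) simp_all
        moreover have "d \<noteq> 2" using d(1) by (auto simp: h_def)
        ultimately have "d = 1" by linarith
        then show "is_unit d" by simp
      qed
      then obtain a c where ac: "(h - 1) * (g - 1) + j = a * h + c * g"
        using nonneg_combination[OF _ _ g(1), of h "(h - 1) * (g - 1) + j"] by (fastforce simp: h_def)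
      have "2 * ((h - 1) * (g - 1)) + 2 + 2 * j = a * (2 * h) + c * (2 * g) + 2"
        using scale[OF ac, of 2] by linarith
      moreover have "2 * g + 2 \<in> spec V (nsets V 2) \<gamma>" using s False by simp
      ultimately show ?thesis
        using spec_combination[of "2 * h" V \<gamma> "2 * g" a c] n unfolding h E by metis
    qed
    moreover have "real (2 * ((h - 1) * (g - 1)) + 2) \<le> 9 / 2 * (real n)^2 - 39 * real n + 86"
    proof (cases "x \<le> 4")
      case True
      have "(h - 1) * (g - 1) = 2 * x * (12 * x + 3)"
        using True by (simp add: g_def h_def b_def)
      moreover have "real x \<le> real x * real x" by (cases x) auto
      ultimately show ?thesis by (simp add: x power2_eq_square algebra_simps)
    next
      case False
      have "(h - 1) * (g - 1) = 2 * x * (16 * x + 5)"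
        using False by (simp add: g_def h_def b_def)
      moreover have "4 * real x \<le> real x * real x" using False by (intro mult_right_mono) auto
      ultimately show ?thesis by (simp add: x power2_eq_square algebra_simps)
    qed
    ultimately show "\<exists>N::nat. real N \<le> 9 / 2 * (real n)^2 - 39 * real n + 86 \<and>
        {N + 2 * j | j::nat. j \<ge> 0} \<subseteq> spec V E \<gamma>"
      by blast
  }
qed

end
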